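(* Consider the system of 5 elastoplastic springs on 4 nodes described in the context, with displacement-controlled loading $l(t)=l_0+l_1t$, $l_0,l_1>0$, and assume that its elastic limits satisfy the feasibility condition of one of the scenarios 1–6 listed in the context. Let $I_0$, $Ay_{*,1}$, $Ay_{*,2}$, $\varepsilon_0$, $\sigma_1=\sigma_2$ be the data of that scenario and put $$\tau_d=\frac{\max\{\sqrt{\sigma_1},\sqrt{\sigma_2}\}}{\varepsilon_0}\cdot\|A^{-1}c^+-A^{-1}c^-\|^A .$$ Then, for any initial values of stresses, the 2 springs with the indexes from $I_0$ undergo plastic deformation for $t\ge\tau_d$. During this plastic deformation the stresses of the remaining springs are constant and can admit any constant value from the line segment $[Ay_{*,1},Ay_{*,2}]$. That is, for every solution the stress vector $s(t)$ is constant for $t\ge\tau_d$ and belongs to $[Ay_{*,1},Ay_{*,2}]$ (so $s_j(t)=c_j^+$ for $(+,j)\in I_0$), and every point of this segment is attained in this way by some solution.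
   Context: The system: $m=5$, $n=4$, stiffness matrix $A={\rm diag}(a_1,\dots,a_5)$ with $a_i>0$, elastic limits $c_i^-\le c_i^+$, $c^\pm=(c_1^\pm,\dots,c_5^\pm)^T$, $\|x\|^A=\sqrt{\langle x,Ax\rangle}$, $$D=\begin{pmatrix}-1&1&0&0\\-1&0&1&0\\0&-1&1&0\\0&-1&0&1\\0&0&-1&1\end{pmatrix},\ R=\begin{pmatrix}1\\0\\1\\0\\1\end{pmatrix},\ A\mathcal{V}_{basis}=\begin{pmatrix}0&1&1\\0&1&-1\\1&0&1\\-1&1&0\\1&1&0\end{pmatrix},\ P=\begin{pmatrix}1&0&1&0&1\\0&0&1&-1&1\\1&-1&1&0&0\end{pmatrix}.$$ $\mathcal{V}=\mathcal{V}_{basis}\mathbb{R}^3$ with scalar product $\langle x,Ay\rangle$; $c(t)=-\mathcal{V}_{basis}(P\mathcal{V}_{basis})^{-1}(1,0,0)^Tl(t)$; $C=\{y\in\mathcal{V}:c_i^-\le\langle e_i,Ay\rangle\le c_i^+,\ i=1,\dots,5\}$. The evolution is given by the sweeping process $-\dot y(t)\in N^A_{C+c(t)}(y(t))$ for a.e. $t\ge0$, $y(t)\in C+c(t)$, with $y(0)\in C+c(0)$ arbitrary and $y$ locally absolutely continuous, where for a closed convex set $K\subset\mathcal{V}$, $N^A_K(y)=\{x\in\mathcal{V}:\langle x,A(\xi-y)\rangle\le0\ \forall\xi\in K\}$ for $y\in K$. The stress vector is $s(t)=A(y(t)-c(t))$. Spring $j$ undergoes plastic deformation when $c_j^-<s_j<c_j^+$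 is violated, i.e. $s_j\in\{c_j^-,c_j^+\}$. Scenarios: $I_0=\{(+,1),(+,2)\}$ in scenarios 1–3 and $I_0=\{(+,4),(+,5)\}$ in scenarios 4–6. Below, $Ay_{*,1}$ and $Ay_{*,2}$ are obtained from the displayed vector with the sign $\mp$ taken as $-$ and $+$ respectively, and the feasibility condition is required for both signs. Put $Q=a_4a_5+a_3(a_4+a_5)$, $S=a_1a_2+a_3(a_1+a_2)$, $E=a_3a_4+a_2(a_3+a_4)+a_3a_5+a_4a_5+a_1(a_2+a_3+a_5)$. 1: $(c_1^+,c_2^+,c_3^\mp,c_1^+-c_3^\mp,c_2^++c_3^\mp)$; $c_4^-\le c_1^+-c_3^\mp\le c_4^+$, $c_5^-\le c_2^++c_3^\mp\le c_5^+$; $\sigma_1=\sigma_2=\max\{1,\frac{(a_1+a_4)(a_2+a_5)Q}{a_4a_5E}\}$. 2: $(c_1^+,c_2^+,c_1^+-c_4^\mp,c_4^\mp,c_1^++c_2^+-c_4^\mp)$; $c_3^-\le c_1^+-c_4^\mp\le c_3^+$, $c_5^-\le c_1^++c_2^+-c_4^\mp\le c_5^+$; $\sigma_1=\sigma_2=\max\{1,\frac{(a_3(a_2+a_5)+a_1(a_2+a_3+a_5))Q}{a_3a_5E}\}$. 3: $(c_1^+,c_2^+,-c_2^++c_5^\mp,c_1^++c_2^+-c_5^\mp,c_5^\mp)$; $c_3^-\le-c_2^++c_5^\mp\le c_3^+$, $c_4^-\le c_1^++c_2^+-c_5^\mp\le c_4^+$; $\sigma_1=\sigma_2=\max\{1,\frac{(a_1(a_2+a_3)+a_3a_4+a_2(a_3+a_4))Q}{a_3a_4E}\}$.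 4: $(c_1^\mp,-c_1^\mp+c_4^++c_5^+,c_1^\mp-c_4^+,c_4^+,c_5^+)$; $c_2^-\le-c_1^\mp+c_4^++c_5^+\le c_2^+$, $c_3^-\le c_1^\mp-c_4^+\le c_3^+$; $\sigma_1=\sigma_2=\max\{1,\frac{S(a_2(a_3+a_4)+a_4a_5+a_3(a_4+a_5))}{a_2a_3E}\}$. 5: $(-c_2^\mp+c_4^++c_5^+,c_2^\mp,-c_2^\mp+c_5^+,c_4^+,c_5^+)$; $c_1^-\le-c_2^\mp+c_4^++c_5^+\le c_1^+$, $c_3^-\le-c_2^\mp+c_5^+\le c_3^+$; $\sigma_1=\sigma_2=\max\{1,\frac{S(a_4a_5+a_1(a_3+a_5)+a_3(a_4+a_5))}{a_1a_3E}\}$. 6: $(c_3^\mp+c_4^+,-c_3^\mp+c_5^+,c_3^\mp,c_4^+,c_5^+)$; $c_1^-\le c_3^\mp+c_4^+\le c_1^+$, $c_2^-\le-c_3^\mp+c_5^+\le c_2^+$; $\sigma_1=\sigma_2=\max\{1,\frac{S(a_1+a_4)(a_2+a_5)}{a_1a_2E}\}$. The value of $\varepsilon_0$: in scenarios 1–3, $\varepsilon_0=\min\{h(a_2,a_4),h(a_1,a_5)\}$ with $h(x,y)=l_1\sqrt{\frac{xQ}{x(a_3+y)+Q}}$; in scenarios 4–6, $\varepsilon_0=\min\{h(a_5,a_1),h(a_4,a_2)\}$ with $h(x,y)=l_1\sqrt{\frac{xS}{x(a_3+y)+S}}$. *)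

theory Defs
  imports "HOL-Analysis.Analysis"
begin

text \<open>
  Springs are indexed by the type \<^typ>\<open>5\<close> and nodes by \<^typ>\<open>4\<close>. In these types
  \<open>5 = 0\<close> and \<open>4 = 0\<close> respectively, so that 1, 2, 3, 4, 5 are the five distinct indices.
\<close>

subsection \<open>The network\<close>

definition D_mat :: "real^4^5" where
  "D_mat = vector [vector [-1, 1, 0, 0],
                   vector [-1, 0, 1, 0],
                   vector [0, -1, 1, 0],
                   vector [0, -1, 0, 1],
                   vector [0, 0, -1, 1]]"

definition R_vec :: "real^5" where
  "R_vec = vector [1, 0, 1, 0, 1]"

definition A_V_basis :: "real^3^5" where
  "A_V_basis = vector [vector [0, 1, 1],
                       vector [0, 1, -1],
                       vector [1, 0, 1],
                       vector [-1, 1, 0],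
                       vector [1, 1, 0]]"

definition P_mat :: "real^5^3" where
  "P_mat = vector [vector [1, 0, 1, 0, 1],
                   vector [0, 0, 1, -1, 1],
                   vector [1, -1, 1, 0, 0]]"

text \<open>The parameter \<open>a\<close> is the vector of spring stiffnesses. The process below is given by
  \<open>A_V_basis\<close> and \<open>P_mat\<close>; their relation to \<open>D_mat\<close> and \<open>R_vec\<close> is the content of
  \<open>V_space_iff\<close> and \<open>P_mat_D_mat\<close>.\<close>

definition stiffness :: "real^5 \<Rightarrow> real^5^5" where
  "stiffness a = (\<chi> i j. if i = j then a $ i else 0)"

definition inner_A :: "real^5 \<Rightarrow> real^5 \<Rightarrow> real^5 \<Rightarrow> real" where
  "inner_A a x y = x \<bullet> (stiffness a *v y)"

definition norm_A :: "real^5 \<Rightarrow> real^5 \<Rightarrow> real" where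
  "norm_A a x = sqrt (inner_A a x x)"

definition V_basis :: "real^5 \<Rightarrow> real^3^5" where
  "V_basis a = matrix_inv (stiffness a) ** A_V_basis"

definition V_space :: "real^5 \<Rightarrow> (real^5) set" where
  "V_space a = range (\<lambda>v. V_basis a *v v)"

subsection \<open>The sweeping process\<close>

text \<open>
  The elastic limits are a function \<open>cl\<close> with \<open>cl Plus\<close> and \<open>cl Minus\<close> the vectors of
  upper and lower limits. The displacement-controlled loading is \<open>l\<close>.
\<close>

datatype side = Minus | Plus

definition offset :: "real^5 \<Rightarrow> (real \<Rightarrow> real) \<Rightarrow> real \<Rightarrow> real^5" where
  "offset a l t =
     - ((V_basis a ** matrix_inv (P_mat ** V_basis a)) *v (l t *\<^sub>R vector [1, 0, 0]))"

definition elastic_set :: "real^5 \<Rightarrow> (side \<Rightarrow> real^5) \<Rightarrow> (real^5) set" where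
  "elastic_set a cl =
     {y \<in> V_space a. \<forall>i. cl Minus $ i \<le> inner_A a (axis i 1) y \<and>
                        inner_A a (axis i 1) y \<le> cl Plus $ i}"

definition moving_set :: "real^5 \<Rightarrow> (side \<Rightarrow> real^5) \<Rightarrow> (real \<Rightarrow> real) \<Rightarrow> real \<Rightarrow> (real^5) set" where
  "moving_set a cl l t = (\<lambda>x. x + offset a l t) ` elastic_set a cl"

definition normal_cone :: "real^5 \<Rightarrow> (real^5) set \<Rightarrow> real^5 \<Rightarrow> (real^5) set" where
  "normal_cone a K y =
     {x \<in> V_space a. y \<in> K \<and> (\<forall>\<xi>\<in>K. inner_A a x (\<xi> - y) \<le> 0)}"

text \<open>
  In \<open>\<D> division_of T\<close> the members of \<open>\<D>\<close> are nonempty closed intervals with pairwise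
  disjoint interiors; degenerate ones contribute \<open>0\<close> to both sums below.
\<close>

definition absolutely_continuous_on :: "(real \<Rightarrow> real^5) \<Rightarrow> real set \<Rightarrow> bool" where
  "absolutely_continuous_on f S \<longleftrightarrow>
     (\<forall>\<epsilon>>0. \<exists>\<delta>>0. \<forall>\<D> T. \<D> division_of T \<and> T \<subseteq> S \<and> (\<Sum>K\<in>\<D>. Sup K - Inf K) < \<delta> \<longrightarrow>
        (\<Sum>K\<in>\<D>. norm (f (Sup K) - f (Inf K))) < \<epsilon>)"

definition locally_absolutely_continuous_on :: "(real \<Rightarrow> real^5) \<Rightarrow> real set \<Rightarrow> bool" where
  "locally_absolutely_continuous_on f S \<longleftrightarrow>
     (\<forall>u v. {u..v} \<subseteq> S \<longrightarrow> absolutely_continuous_on f {u..v})"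

text \<open>Values of \<open>y\<close> at negative times are irrelevant.\<close>

definition sweeping_solution ::
    "real^5 \<Rightarrow> (side \<Rightarrow> real^5) \<Rightarrow> (real \<Rightarrow> real) \<Rightarrow> (real \<Rightarrow> real^5) \<Rightarrow> bool" where
  "sweeping_solution a cl l y \<longleftrightarrow>
     locally_absolutely_continuous_on y {0..} \<and>
     (\<forall>t\<ge>0. y t \<in> moving_set a cl l t) \<and>
     (AE t in lebesgue. t \<ge> 0 \<longrightarrow>
        (\<exists>y'. (y has_vector_derivative y') (at t within {0..}) \<and>
              - y' \<in> normal_cone a (moving_set a cl l t) (y t)))"

definition stress :: "real^5 \<Rightarrow> (real \<Rightarrow> real) \<Rightarrow> (real \<Rightarrow> real^5) \<Rightarrow> real \<Rightarrow> real^5" where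
  "stress a l y t = stiffness a *v (y t - offset a l t)"

definition plastic :: "(side \<Rightarrow> real^5) \<Rightarrow> real^5 \<Rightarrow> 5 \<Rightarrow> bool" where
  "plastic cl s j \<longleftrightarrow> \<not> (cl Minus $ j < s $ j \<and> s $ j < cl Plus $ j)"

subsection \<open>The scenarios\<close>

datatype scenario = Scenario1 | Scenario2 | Scenario3 | Scenario4 | Scenario5 | Scenario6

fun I0 :: "scenario \<Rightarrow> (side \<times> 5) set" where
  "I0 Scenario1 = {(Plus, 1), (Plus, 2)}"
| "I0 Scenario2 = {(Plus, 1), (Plus, 2)}"
| "I0 Scenario3 = {(Plus, 1), (Plus, 2)}"
| "I0 Scenario4 = {(Plus, 4), (Plus, 5)}"
| "I0 Scenario5 = {(Plus, 4), (Plus, 5)}"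
| "I0 Scenario6 = {(Plus, 4), (Plus, 5)}"

text \<open>
  \<open>Ay_star sc cl \<theta>\<close> is the vector \<open>A y\<^sub>*\<^sub>,\<^sub>1\<close> for \<open>\<theta> = Minus\<close> and
  \<open>A y\<^sub>*\<^sub>,\<^sub>2\<close> for \<open>\<theta> = Plus\<close>.
\<close>

fun Ay_star :: "scenario \<Rightarrow> (side \<Rightarrow> real^5) \<Rightarrow> side \<Rightarrow> real^5" where
  "Ay_star Scenario1 cl \<theta> = vector
     [cl Plus $ 1,
      cl Plus $ 2,
      cl \<theta> $ 3,
      cl Plus $ 1 - cl \<theta> $ 3,
      cl Plus $ 2 + cl \<theta> $ 3]"
| "Ay_star Scenario2 cl \<theta> = vector
     [cl Plus $ 1,
      cl Plus $ 2,
      cl Plus $ 1 - cl \<theta> $ 4,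
      cl \<theta> $ 4,
      cl Plus $ 1 + cl Plus $ 2 - cl \<theta> $ 4]"
| "Ay_star Scenario3 cl \<theta> = vector
     [cl Plus $ 1,
      cl Plus $ 2,
      - cl Plus $ 2 + cl \<theta> $ 5,
      cl Plus $ 1 + cl Plus $ 2 - cl \<theta> $ 5,
      cl \<theta> $ 5]"
| "Ay_star Scenario4 cl \<theta> = vector
     [cl \<theta> $ 1,
      - cl \<theta> $ 1 + cl Plus $ 4 + cl Plus $ 5,
      cl \<theta> $ 1 - cl Plus $ 4,
      cl Plus $ 4,
      cl Plus $ 5]"
| "Ay_star Scenario5 cl \<theta> = vector
     [- cl \<theta> $ 2 + cl Plus $ 4 + cl Plus $ 5,
      cl \<theta> $ 2,
      - cl \<theta> $ 2 + cl Plus $ 5,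
      cl Plus $ 4,
      cl Plus $ 5]"
| "Ay_star Scenario6 cl \<theta> = vector
     [cl \<theta> $ 3 + cl Plus $ 4,
      - cl \<theta> $ 3 + cl Plus $ 5,
      cl \<theta> $ 3,
      cl Plus $ 4,
      cl Plus $ 5]"

definition within_limits :: "(side \<Rightarrow> real^5) \<Rightarrow> 5 \<Rightarrow> real \<Rightarrow> bool" where
  "within_limits cl i r \<longleftrightarrow> cl Minus $ i \<le> r \<and> r \<le> cl Plus $ i"

fun feasible_at :: "scenario \<Rightarrow> (side \<Rightarrow> real^5) \<Rightarrow> side \<Rightarrow> bool" where
  "feasible_at Scenario1 cl \<theta> \<longleftrightarrow>
     within_limits cl 4 (cl Plus $ 1 - cl \<theta> $ 3) \<and>
     within_limits cl 5 (cl Plus $ 2 + cl \<theta> $ 3)"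
| "feasible_at Scenario2 cl \<theta> \<longleftrightarrow>
     within_limits cl 3 (cl Plus $ 1 - cl \<theta> $ 4) \<and>
     within_limits cl 5 (cl Plus $ 1 + cl Plus $ 2 - cl \<theta> $ 4)"
| "feasible_at Scenario3 cl \<theta> \<longleftrightarrow>
     within_limits cl 3 (- cl Plus $ 2 + cl \<theta> $ 5) \<and>
     within_limits cl 4 (cl Plus $ 1 + cl Plus $ 2 - cl \<theta> $ 5)"
| "feasible_at Scenario4 cl \<theta> \<longleftrightarrow>
     within_limits cl 2 (- cl \<theta> $ 1 + cl Plus $ 4 + cl Plus $ 5) \<and>
     within_limits cl 3 (cl \<theta> $ 1 - cl Plus $ 4)"
| "feasible_at Scenario5 cl \<theta> \<longleftrightarrow>
     within_limits cl 1 (- cl \<theta> $ 2 + cl Plus $ 4 + cl Plus $ 5) \<and>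
     within_limits cl 3 (- cl \<theta> $ 2 + cl Plus $ 5)"
| "feasible_at Scenario6 cl \<theta> \<longleftrightarrow>
     within_limits cl 1 (cl \<theta> $ 3 + cl Plus $ 4) \<and>
     within_limits cl 2 (- cl \<theta> $ 3 + cl Plus $ 5)"

definition feasible :: "scenario \<Rightarrow> (side \<Rightarrow> real^5) \<Rightarrow> bool" where
  "feasible sc cl \<longleftrightarrow> (\<forall>\<theta>. feasible_at sc cl \<theta>)"

definition Q_of :: "real^5 \<Rightarrow> real" where
  "Q_of a = a$4 * a$5 + a$3 * (a$4 + a$5)"

definition S_of :: "real^5 \<Rightarrow> real" where
  "S_of a = a$1 * a$2 + a$3 * (a$1 + a$2)"

definition E_of :: "real^5 \<Rightarrow> real" where
  "E_of a = a$3 * a$4 + a$2 * (a$3 + a$4) + a$3 * a$5 + a$4 * a$5 + a$1 * (a$2 + a$3 + a$5)"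

text \<open>The common value of \<open>\<sigma>\<^sub>1\<close> and \<open>\<sigma>\<^sub>2\<close>.\<close>

fun sigma_of :: "scenario \<Rightarrow> real^5 \<Rightarrow> real" where
  "sigma_of Scenario1 a = max 1
     ((a$1 + a$4) * (a$2 + a$5) * Q_of a / (a$4 * a$5 * E_of a))"
| "sigma_of Scenario2 a = max 1
     ((a$3 * (a$2 + a$5) + a$1 * (a$2 + a$3 + a$5)) * Q_of a / (a$3 * a$5 * E_of a))"
| "sigma_of Scenario3 a = max 1
     ((a$1 * (a$2 + a$3) + a$3 * a$4 + a$2 * (a$3 + a$4)) * Q_of a / (a$3 * a$4 * E_of a))"
| "sigma_of Scenario4 a = max 1
     (S_of a * (a$2 * (a$3 + a$4) + a$4 * a$5 + a$3 * (a$4 + a$5)) / (a$2 * a$3 * E_of a))"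
| "sigma_of Scenario5 a = max 1
     (S_of a * (a$4 * a$5 + a$1 * (a$3 + a$5) + a$3 * (a$4 + a$5)) / (a$1 * a$3 * E_of a))"
| "sigma_of Scenario6 a = max 1
     (S_of a * (a$1 + a$4) * (a$2 + a$5) / (a$1 * a$2 * E_of a))"

text \<open>The function \<open>h\<close>, with \<open>q\<close> standing for \<open>Q\<close> or \<open>S\<close>.\<close>

definition h_of :: "real^5 \<Rightarrow> real \<Rightarrow> real \<Rightarrow> real \<Rightarrow> real \<Rightarrow> real" where
  "h_of a l1 q x y = l1 * sqrt (x * q / (x * (a$3 + y) + q))"

definition eps0_upper :: "real^5 \<Rightarrow> real \<Rightarrow> real" where
  "eps0_upper a l1 = min (h_of a l1 (Q_of a) (a$2) (a$4)) (h_of a l1 (Q_of a) (a$1) (a$5))"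

definition eps0_lower :: "real^5 \<Rightarrow> real \<Rightarrow> real" where
  "eps0_lower a l1 = min (h_of a l1 (S_of a) (a$5) (a$1)) (h_of a l1 (S_of a) (a$4) (a$2))"

fun eps0 :: "scenario \<Rightarrow> real^5 \<Rightarrow> real \<Rightarrow> real" where
  "eps0 Scenario1 a l1 = eps0_upper a l1"
| "eps0 Scenario2 a l1 = eps0_upper a l1"
| "eps0 Scenario3 a l1 = eps0_upper a l1"
| "eps0 Scenario4 a l1 = eps0_lower a l1"
| "eps0 Scenario5 a l1 = eps0_lower a l1"
| "eps0 Scenario6 a l1 = eps0_lower a l1"

definition tau_d :: "real^5 \<Rightarrow> (side \<Rightarrow> real^5) \<Rightarrow> real \<Rightarrow> real \<Rightarrow> real \<Rightarrow> real" where
  "tau_d a cl \<sigma>\<^sub>1 \<sigma>\<^sub>2 \<epsilon>\<^sub>0 =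
     max (sqrt \<sigma>\<^sub>1) (sqrt \<sigma>\<^sub>2) / \<epsilon>\<^sub>0 *
     norm_A a (matrix_inv (stiffness a) *v cl Plus - matrix_inv (stiffness a) *v cl Minus)"

subsection \<open>Basic properties\<close>

lemma exhaust_5:
  fixes x :: 5
  shows "x = 1 \<or> x = 2 \<or> x = 3 \<or> x = 4 \<or> x = 5"
proof (induct x)
  case (of_int z)
  then have "0 \<le> z" and "z < 5" by simp_all
  then have "z = 0 \<or> z = 1 \<or> z = 2 \<or> z = 3 \<or> z = 4" by arith
  then show ?case by auto
qed

lemma forall_5: "(\<forall>i::5. Q i) \<longleftrightarrow> Q 1 \<and> Q 2 \<and> Q 3 \<and> Q 4 \<and> Q 5"
  by (metis exhaust_5)

lemma UNIV_5: "UNIV = {1, 2, 3, 4, 5::5}"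
  using exhaust_5 by auto

lemma sum_5: "sum f (UNIV::5 set) = f 1 + f 2 + f 3 + f 4 + f 5"
  unfolding UNIV_5 by (simp add: ac_simps)

lemma vector_4' [simp]:
  "(vector [x1, x2, x3, x4] :: 'a::zero^4) $ 1 = x1"
  "(vector [x1, x2, x3, x4] :: 'a::zero^4) $ 2 = x2"
  "(vector [x1, x2, x3, x4] :: 'a::zero^4) $ 3 = x3"
  "(vector [x1, x2, x3, x4] :: 'a::zero^4) $ 4 = x4"
  unfolding vector_def by simp_all

lemma vector_5 [simp]:
  "(vector [x1, x2, x3, x4, x5] :: 'a::zero^5) $ 1 = x1"
  "(vector [x1, x2, x3, x4, x5] :: 'a::zero^5) $ 2 = x2"
  "(vector [x1, x2, x3, x4, x5] :: 'a::zero^5) $ 3 = x3"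
  "(vector [x1, x2, x3, x4, x5] :: 'a::zero^5) $ 4 = x4"
  "(vector [x1, x2, x3, x4, x5] :: 'a::zero^5) $ 5 = x5"
  unfolding vector_def by simp_all

lemma stiffness_mult_component: "(stiffness a *v x) $ i = a $ i * x $ i"
  by (simp add: stiffness_def matrix_vector_mult_def if_distrib[of "\<lambda>z. z * _"] cong: if_cong)

lemma matrix_inv_stiffness:
  assumes "\<forall>i. 0 < a $ i"
  shows "matrix_inv (stiffness a) = (\<chi> i j. if i = j then inverse (a $ i) else 0)"
proof -
  let ?B = "(\<chi> i j. if i = j then inverse (a $ i) else 0) :: real^5^5"
  have nz: "a $ i \<noteq> 0" for i using assms by (metis less_irrefl)
  have AB: "stiffness a ** ?B = mat 1" and BA: "?B ** stiffness a = mat 1"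
    using nz
    by (auto simp: stiffness_def matrix_matrix_mult_def mat_def vec_eq_iff
        if_distrib[of "\<lambda>z. z * _"] cong: if_cong)
  then have "\<exists>B. stiffness a ** B = mat 1 \<and> B ** stiffness a = mat 1" by blast
  then have inv: "stiffness a ** matrix_inv (stiffness a) = mat 1 \<and>
      matrix_inv (stiffness a) ** stiffness a = mat 1"
    unfolding matrix_inv_def by (rule someI_ex)
  have "matrix_inv (stiffness a) = matrix_inv (stiffness a) ** (stiffness a ** ?B)"
    by (simp add: AB)
  also have "\<dots> = ?B"
    using inv by (simp add: matrix_mul_assoc)
  finally show ?thesis .
qed

lemma V_basis_mult_component:
  assumes "\<forall>i. 0 < a $ i"
  shows "(V_basis a *v v) $ i = inverse (a $ i) * (A_V_basis *v v) $ i"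
  by (simp add: V_basis_def matrix_inv_stiffness[OF assms] flip: matrix_vector_mul_assoc)
    (simp add: matrix_vector_mult_def[of "\<chi> i j. _ i j"] if_distrib[of "\<lambda>z. z * _"] cong: if_cong)

lemma A_V_basis_eq:
  assumes "\<forall>i. 0 < a $ i"
  shows "stiffness a ** V_basis a = A_V_basis"
proof -
  have nz: "a $ i \<noteq> 0" for i using assms by (metis less_irrefl)
  have "stiffness a ** matrix_inv (stiffness a) = mat 1"
    unfolding matrix_inv_stiffness[OF assms] using nz
    by (auto simp: stiffness_def matrix_matrix_mult_def mat_def vec_eq_iff
        if_distrib[of "\<lambda>z. z * _"] cong: if_cong)
  then show ?thesis by (simp add: V_basis_def matrix_mul_assoc)
qed

text \<open>\<open>V\<close> consists of the elongations whose stresses are balanced at the two inner nodes.\<close>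

lemma V_space_iff:
  assumes "\<forall>i. 0 < a $ i"
  shows "x \<in> V_space a \<longleftrightarrow> (\<forall>\<xi>. R_vec \<bullet> (D_mat *v \<xi>) = 0 \<longrightarrow> inner_A a x (D_mat *v \<xi>) = 0)"
proof
  have nz: "a $ i \<noteq> 0" for i using assms by (metis less_irrefl)
  have cancel: "a $ i * (inverse (a $ i) * r) = r" for i r
    using nz[of i] by simp
  have inner: "inner_A a y z = (\<Sum>i\<in>UNIV. a $ i * y $ i * z $ i)" for y z
    by (simp add: inner_A_def inner_vec_def stiffness_mult_component ac_simps)
  {
    assume "x \<in> V_space a"
    then obtain v where x: "x = V_basis a *v v" by (auto simp: V_space_def)
    show "\<forall>\<xi>. R_vec \<bullet> (D_mat *v \<xi>) = 0 \<longrightarrow> inner_A a x (D_mat *v \<xi>) = 0"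
    proof (intro allI impI)
      fix \<xi> :: "real^4"
      assume "R_vec \<bullet> (D_mat *v \<xi>) = 0"
      then have 1: "\<xi> $ 4 = \<xi> $ 1"
        by (simp add: sum_5 sum_4 R_vec_def D_mat_def matrix_vector_mult_def inner_vec_def)
      have "inner_A a x (D_mat *v \<xi>) = (\<Sum>i\<in>UNIV. (A_V_basis *v v) $ i * (D_mat *v \<xi>) $ i)"
        unfolding inner x V_basis_mult_component[OF assms] cancel ..
      also have "\<dots> = 0"
        by (simp add: sum_5 sum_4 sum_3 D_mat_def A_V_basis_def matrix_vector_mult_def 1)
          (simp add: algebra_simps)
      finally show "inner_A a x (D_mat *v \<xi>) = 0" .
    qed
  next
    assume *: "\<forall>\<xi>. R_vec \<bullet> (D_mat *v \<xi>) = 0 \<longrightarrow> inner_A a x (D_mat *v \<xi>) = 0"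
    have e1: "a$1 * x$1 = a$3 * x$3 + a$4 * x$4"
      using *[rule_format, of "vector [0, 1, 0, 0]"] unfolding inner
      by (simp add: sum_5 sum_4 R_vec_def D_mat_def matrix_vector_mult_def inner_vec_def)
    have e2: "a$5 * x$5 = a$2 * x$2 + a$3 * x$3"
      using *[rule_format, of "vector [0, 0, 1, 0]"] unfolding inner
      by (simp add: sum_5 sum_4 R_vec_def D_mat_def matrix_vector_mult_def inner_vec_def)
    let ?v = "vector [a$3 * x$3 - (a$1 * x$1 - a$2 * x$2) / 2,
                      (a$1 * x$1 + a$2 * x$2) / 2, (a$1 * x$1 - a$2 * x$2) / 2] :: real^3"
    have "(A_V_basis *v ?v) $ i = a $ i * x $ i" for i
      using exhaust_5[of i] e1 e2
      by (auto simp: sum_3 A_V_basis_def matrix_vector_mult_def field_simps)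
    then have "V_basis a *v ?v = x"
      using nz by (simp add: vec_eq_iff V_basis_mult_component[OF assms])
    then show "x \<in> V_space a" unfolding V_space_def by (rule range_eqI[OF sym])
  }
qed

lemma P_mat_D_mat:
  "P_mat *v (D_mat *v \<xi>) = vector [R_vec \<bullet> (D_mat *v \<xi>), 0, 0]"
  by (simp add: vec_eq_iff forall_3 P_mat_def D_mat_def R_vec_def matrix_vector_mult_def inner_vec_def
      sum_5 sum_4)

lemma invertible_P_mat_V_basis:
  assumes "\<forall>i. 0 < a $ i"
  shows "invertible (P_mat ** V_basis a)"
proof -
  define b where "b i = inverse (a $ i)" for i
  have pos: "0 < b i" for i using assms by (simp add: b_def)
  have comp: "(P_mat ** V_basis a) $ i $ j = (\<Sum>k\<in>UNIV. P_mat $ i $ k * (b k * A_V_basis $ k $ j))" for i j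
  proof -
    have "V_basis a $ k $ j = b k * A_V_basis $ k $ j" for k
      by (simp add: V_basis_def matrix_inv_stiffness[OF assms] b_def matrix_matrix_mult_def
          if_distrib[of "\<lambda>z. z * _"] cong: if_cong)
    then show ?thesis by (simp add: matrix_matrix_mult_def)
  qed
  have "det (P_mat ** V_basis a) =
    - 2 * (b 1 * b 2 * b 3 + b 1 * b 2 * b 4 + b 1 * b 2 * b 5 +
      b 1 * b 3 * b 5 + b 1 * b 4 * b 5 + b 2 * b 3 * b 4 + b 2 * b 4 * b 5 + b 3 * b 4 * b 5)"
    unfolding det_3 comp by (simp add: sum_5 P_mat_def A_V_basis_def algebra_simps)
  moreover have pos3: "0 < b i * b j * b k" for i j k using pos by simp
  have "0 < b 1 * b 2 * b 3 + b 1 * b 2 * b 4 + b 1 * b 2 * b 5 +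
      b 1 * b 3 * b 5 + b 1 * b 4 * b 5 + b 2 * b 3 * b 4 + b 2 * b 4 * b 5 + b 3 * b 4 * b 5"
    by (intro add_pos_pos pos3)
  ultimately have "det (P_mat ** V_basis a) \<noteq> 0"
    by (metis less_irrefl mult_eq_0_iff neg_equal_0_iff_equal zero_neq_numeral)
  then show ?thesis by (simp add: invertible_det_nz)
qed

end

theory Submission
  imports Defs
begin

text \<open>
  In stress coordinates the moving set is a fixed convex set of balanced stresses and the process is
  the gradient flow, for the quadratic form \<open>energy\<close>, of the linear functional
  \<open>l\<^sub>1 (s\<^sub>1 + s\<^sub>2) = l\<^sub>1 (s\<^sub>4 + s\<^sub>5)\<close>. Its maximum is attained on the segment between the two points
  \<open>A y\<^sub>*\<close>. The deficit of the functional at \<open>s\<close> is at least \<open>\<epsilon>\<^sub>0\<close> times the distance of \<open>s\<close> from the line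
  carrying the segment, and the distance from the segment is at most \<open>sqrt \<sigma>\<close> times the
  distance from the line: if the projection to the line misses the segment, then \<open>s\<close> still satisfies the
  constraint violated by the projection, and \<open>sqrt \<sigma>\<close> is the reciprocal of the sine of the
  angle between the line and that constraint plane. Hence the distance from the segment decreases at rate
  at least \<open>\<epsilon>\<^sub>0 / sqrt \<sigma>\<close> until it vanishes; afterwards the distance from the point that was reached
  cannot increase, so the stress stays there.
\<close>

subsection \<open>Monotonicity from the sign of the derivative almost everywhere\<close>

text \<open>Outer regularity gives an open set around \<open>N\<close> of measure below
  \<open>\<delta>\<close>. The intervals of a tagged partial division do not overlap, so their total
  length is the measure of their union, which lies in that open set.\<close>

lemma negligible_open_cover_length:
  assumes N: "negligible N" and "0 < \<delta>"
  obtains G where "open G" "N \<subseteq> G"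
    "\<And>p S. p tagged_partial_division_of S \<Longrightarrow> \<Union>(snd ` p) \<subseteq> G \<Longrightarrow>
       (\<Sum>K\<in>snd ` p. Sup K - Inf K :: real) < \<delta>"
proof -
  have "N \<in> sets lebesgue" using N by (simp add: negligible_imp_sets)
  then obtain G where G: "open G" "N \<subseteq> G" "G - N \<in> lmeasurable" "emeasure lebesgue (G - N) < ennreal \<delta>"
    using sets_lebesgue_outer_open \<open>0 < \<delta>\<close> by metis
  have small: "measure lebesgue (G - N) < \<delta>"
    using G(3,4) \<open>0 < \<delta>\<close> by (simp add: emeasure_eq_measure2 ennreal_less_iff)
  have NL: "N \<in> lmeasurable" using N by (simp add: negligible_imp_measurable)
  have GL: "G \<in> lmeasurable"
    using fmeasurable.Un[OF G(3) NL] G(2) by (simp add: Un_absorb2)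
  have "measure lebesgue G \<le> measure lebesgue (G - N) + measure lebesgue N"
    using measure_Un_le[of "G - N" lebesgue N] G(2,3) NL by (simp add: Un_absorb2 fmeasurableD)
  also have "measure lebesgue N = 0" using N by (rule negligible_imp_measure0)
  finally have *: "measure lebesgue G < \<delta>" using small by simp
  show thesis
  proof (rule that[OF G(1,2)])
    fix p S assume p: "p tagged_partial_division_of S" and sub: "\<Union>(snd ` p) \<subseteq> G"
    have div: "(snd ` p) division_of \<Union>(snd ` p)"
      by (rule division_of_tagged_division[OF tagged_partial_division_of_Union_self[OF p]])
    have "(\<Sum>K\<in>snd ` p. Sup K - Inf K) = (\<Sum>K\<in>snd ` p. measure lebesgue K)"
    proof (rule sum.cong[OF refl])
      fix K assume "K \<in> snd ` p"
      then obtain c d where "K = cbox c d" "K \<noteq> {}" using division_ofD(3,4)[OF div] by metis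
      then show "Sup K - Inf K = measure lebesgue K" by simp
    qed
    also have "\<dots> = measure lebesgue (\<Union>(snd ` p))" by (rule content_division[OF div])
    also have "\<dots> \<le> measure lebesgue G"
      using lmeasurable_division[OF div] GL sub by (simp add: measure_mono_fmeasurable fmeasurableD)
    finally show "(\<Sum>K\<in>snd ` p. Sup K - Inf K) < \<delta>" using * by simp
  qed
qed

text \<open>This is the one-sided straddle lemma: since the tag lies between the end points, the
  errors of the linear approximation on its two sides add up to at most
  \<open>\<epsilon> * (v - u)\<close>.\<close>

lemma straddle_nonincreasing:
  fixes f :: "real \<Rightarrow> real"
  assumes f: "(f has_real_derivative D) (at t within S)" and "D \<le> 0" and "0 < \<epsilon>"
  obtains d where "0 < d" "\<And>u v. u \<in> S \<Longrightarrow> v \<in> S \<Longrightarrow> u \<le> t \<Longrightarrow> t \<le> v \<Longrightarrow>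
     {u..v} \<subseteq> ball t d \<Longrightarrow> f v - f u \<le> \<epsilon> * (v - u)"
proof -
  obtain d where d: "0 < d"
    "\<And>x. x \<in> S \<Longrightarrow> norm (x - t) < d \<Longrightarrow> norm (f x - f t - D * (x - t)) \<le> \<epsilon> * norm (x - t)"
    using f \<open>0 < \<epsilon>\<close> unfolding has_field_derivative_def has_derivative_within_alt by metis
  show thesis
  proof (rule that[OF d(1)])
    fix u v assume *: "u \<in> S" "v \<in> S" "u \<le> t" "t \<le> v" "{u..v} \<subseteq> ball t d"
    then have "u \<in> {u..v}" "v \<in> {u..v}" by auto
    then have "u \<in> ball t d" "v \<in> ball t d" using *(5) by blast+
    then have "\<bar>f u - f t - D * (u - t)\<bar> \<le> \<epsilon> * (t - u)" "\<bar>f v - f t - D * (v - t)\<bar> \<le> \<epsilon> * (v - t)"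
      using d(2)[of u] d(2)[of v] * by (simp_all add: dist_real_def abs_minus_commute)
    moreover have "D * (v - t) \<le> 0" "0 \<le> D * (u - t)"
      using \<open>D \<le> 0\<close> * by (simp_all add: mult_nonpos_nonneg mult_nonpos_nonpos)
    ultimately show "f v - f u \<le> \<epsilon> * (v - u)" by (simp add: algebra_simps)
  qed
qed

text \<open>The increment of \<open>f\<close> is summed over a division that is fine for a suitable
  gauge. Intervals tagged outside \<open>N\<close> are handled by the straddle estimate, those
  tagged in \<open>N\<close> have small total length and hence small total variation of
  \<open>z\<close>. The variation of \<open>f\<close> is controlled through \<open>z\<close> because
  absolute continuity is defined for vector-valued maps, while \<open>f\<close> will be a scalar
  function of \<open>z\<close> and time.\<close>

lemma absolutely_continuous_nonincreasing:
  fixes f :: "real \<Rightarrow> real" and z :: "real \<Rightarrow> real^5"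
  assumes "a \<le> b"
    and ac: "absolutely_continuous_on z {a..b}"
    and lip: "\<And>u v. u \<in> {a..b} \<Longrightarrow> v \<in> {a..b} \<Longrightarrow> \<bar>f u - f v\<bar> \<le> L * (norm (z u - z v) + \<bar>u - v\<bar>)"
    and N: "negligible N"
    and deriv: "\<And>t. t \<in> {a..b} - N \<Longrightarrow> \<exists>D\<le>0. (f has_real_derivative D) (at t within {a..b})"
  shows "f b \<le> f a"
proof (rule field_le_epsilon)
  fix e :: real assume "0 < e"
  define M where "M = max L 1"
  \<comment> \<open>Intervals tagged outside \<open>N\<close> will contribute at most
    \<open>\<epsilon> * (b - a)\<close>, and those tagged in \<open>N\<close> at most
    \<open>2 * M * \<epsilon>\<close>.\<close>
  define \<epsilon> where "\<epsilon> = e / (b - a + 1 + 2 * M)"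
  have M: "0 < M" "L \<le> M" by (auto simp: M_def)
  have \<epsilon>: "0 < \<epsilon>" using \<open>0 < e\<close> \<open>a \<le> b\<close> M by (simp add: \<epsilon>_def)
  obtain \<delta> where \<delta>: "0 < \<delta>" "\<forall>\<D> T. \<D> division_of T \<and> T \<subseteq> {a..b} \<and> (\<Sum>K\<in>\<D>. Sup K - Inf K) < \<delta> \<longrightarrow>
      (\<Sum>K\<in>\<D>. norm (z (Sup K) - z (Inf K))) < \<epsilon>"
    using ac[unfolded absolutely_continuous_on_def, rule_format, OF \<epsilon>] by (elim exE conjE)
  obtain G where G: "open G" "N \<subseteq> G" and
    Gsmall: "\<And>p S. p tagged_partial_division_of S \<Longrightarrow> \<Union>(snd ` p) \<subseteq> G \<Longrightarrow> (\<Sum>K\<in>snd ` p. Sup K - Inf K :: real) < min \<delta> \<epsilon>"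
    using negligible_open_cover_length[OF N, of "min \<delta> \<epsilon>"] \<delta>(1) \<epsilon> by (metis min_less_iff_conj)
  \<comment> \<open>The gauge: around a point of \<open>N\<close> the ball stays inside
    \<open>G\<close>, around any other point of the interval the straddle estimate holds.\<close>
  have "\<exists>d>0. if t \<in> N then ball t d \<subseteq> G else
     t \<in> {a..b} \<longrightarrow> (\<forall>u\<in>{a..b}. \<forall>v\<in>{a..b}. u \<le> t \<longrightarrow> t \<le> v \<longrightarrow> {u..v} \<subseteq> ball t d \<longrightarrow> f v - f u \<le> \<epsilon> * (v - u))" for t
  proof (cases "t \<in> N")
    case True
    then show ?thesis using G by (meson open_contains_ball subsetD)
  next
    case False
    show ?thesis
    proof (cases "t \<in> {a..b}")
      case True
      then obtain D where "D \<le> 0" "(f has_real_derivative D) (at t within {a..b})"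
        using deriv False by blast
      then show ?thesis using straddle_nonincreasing[OF _ _ \<epsilon>, of f D t "{a..b}"] False by metis
    qed (use False in \<open>auto intro: exI[of _ 1]\<close>)
  qed
  then obtain d where d: "\<And>t. 0 < d t" "\<And>t. if t \<in> N then ball t (d t) \<subseteq> G else
     t \<in> {a..b} \<longrightarrow> (\<forall>u\<in>{a..b}. \<forall>v\<in>{a..b}. u \<le> t \<longrightarrow> t \<le> v \<longrightarrow> {u..v} \<subseteq> ball t (d t) \<longrightarrow> f v - f u \<le> \<epsilon> * (v - u))"
    by metis
  have "gauge (\<lambda>t. ball t (d t))" using d(1) by (simp add: gauge_ball_dependent)
  then obtain p where p: "p tagged_division_of {a..b}" and fine: "(\<lambda>t. ball t (d t)) fine p"
    using fine_division_exists_real by metis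
  have finp: "finite p" using p by blast
  let ?h = "\<lambda>K. f (Sup K) - f (Inf K)"
  define r where "r = {(x, K) \<in> p. x \<in> N}"
  have rp: "r \<subseteq> p" by (auto simp: r_def)
  have itv: "\<exists>u v. K = {u..v} \<and> u \<le> x \<and> x \<le> v \<and> u \<in> {a..b} \<and> v \<in> {a..b} \<and> Inf K = u \<and> Sup K = v \<and> {u..v} \<subseteq> ball x (d x)"
    if "(x, K) \<in> p" for x K
  proof -
    have "x \<in> K" "K \<subseteq> {a..b}" using p that by auto
    moreover obtain u v where "K = cbox u v" using p \<open>(x, K) \<in> p\<close> by blast
    moreover have "K \<subseteq> ball x (d x)" using fine that by (auto simp: fine_def)
    ultimately show ?thesis by (auto intro!: exI[of _ u] exI[of _ v])
  qed
  have rpart: "r tagged_partial_division_of {a..b}"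
    by (rule tagged_partial_division_subset[OF conjunct1[OF p[unfolded tagged_division_of_def]] rp])
  have rtag: "r tagged_division_of \<Union>(snd ` r)" by (rule tagged_partial_division_of_Union_self[OF rpart])
  have rdiv: "(snd ` r) division_of \<Union>(snd ` r)" by (rule division_of_tagged_division[OF rtag])
  have "\<Union>(snd ` r) \<subseteq> G"
  proof clarsimp
    fix s x K assume *: "(x, K) \<in> r" "s \<in> K"
    then have "K \<subseteq> ball x (d x)" "x \<in> N" using fine by (auto simp: fine_def r_def)
    then show "s \<in> G" using d(2)[of x] * by auto
  qed
  then have len: "(\<Sum>K\<in>snd ` r. Sup K - Inf K) < min \<delta> \<epsilon>" by (rule Gsmall[OF rpart])
  have "\<Union>(snd ` r) \<subseteq> {a..b}"
  proof -
    have "K \<subseteq> {a..b}" if "(x, K) \<in> r" for x K using that rp p by blast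
    then show ?thesis by fastforce
  qed
  then have small: "(\<Sum>K\<in>snd ` r. norm (z (Sup K) - z (Inf K))) < \<epsilon>"
    using \<delta>(2)[rule_format, of "snd ` r" "\<Union>(snd ` r)"] rdiv len by simp
  have ne: "K \<noteq> {}" if "K \<in> snd ` r" for K using division_ofD(3)[OF rdiv that] .
  \<comment> \<open>The sum over tagged pairs becomes a sum over intervals, the form in which
    absolute continuity applies. This requires the value 0 on every interval with empty interior, so
    the empty set, whose \<open>Sup\<close> and \<open>Inf\<close> carry no information, gets it by
    the conditional.\<close>
  have "(\<Sum>(x, K)\<in>r. ?h K) = (\<Sum>(x, K)\<in>r. if K = {} then 0 else ?h K)"
    using ne[OF imageI] by (intro sum.cong) fastforce+
  also have "\<dots> = (\<Sum>K\<in>snd ` r. if K = {} then 0 else ?h K)"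
  proof (rule sum.over_tagged_division_lemma[OF rtag])
    fix u v :: real assume "box u v = {}"
    then show "(if cbox u v = {} then 0 else ?h (cbox u v)) = 0" by auto
  qed
  also have "\<dots> = (\<Sum>K\<in>snd ` r. ?h K)"
    using ne by (intro sum.cong) auto
  also have "\<dots> \<le> (\<Sum>K\<in>snd ` r. M * (norm (z (Sup K) - z (Inf K)) + (Sup K - Inf K)))"
  proof (rule sum_mono)
    fix K assume "K \<in> snd ` r"
    then obtain x where "(x, K) \<in> p" using rp by auto
    from itv[OF this] have K: "Sup K \<in> {a..b}" "Inf K \<in> {a..b}" "Inf K \<le> Sup K" by auto
    from lip[OF K(1,2)] K(3) have "?h K \<le> L * (norm (z (Sup K) - z (Inf K)) + (Sup K - Inf K))" by simp
    also have "\<dots> \<le> M * (norm (z (Sup K) - z (Inf K)) + (Sup K - Inf K))"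
      using M K(3) by (intro mult_right_mono) auto
    finally show "?h K \<le> M * (norm (z (Sup K) - z (Inf K)) + (Sup K - Inf K))" .
  qed
  also have "\<dots> = M * ((\<Sum>K\<in>snd ` r. norm (z (Sup K) - z (Inf K))) + (\<Sum>K\<in>snd ` r. Sup K - Inf K))"
    by (simp only: sum_distrib_left[symmetric] sum.distrib)
  also have "\<dots> \<le> M * (\<epsilon> + \<epsilon>)" using small len M by (intro mult_left_mono) auto
  finally have 1: "(\<Sum>(x, K)\<in>r. ?h K) \<le> M * (\<epsilon> + \<epsilon>)" .
  have "(\<Sum>(x, K)\<in>p - r. ?h K) \<le> (\<Sum>(x, K)\<in>p - r. \<epsilon> * (Sup K - Inf K))"
  proof (rule sum_mono, clarify)
    fix x K assume *: "(x, K) \<in> p" "(x, K) \<notin> r"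
    then have "x \<notin> N" "x \<in> {a..b}" using tag_in_interval[OF p *(1)] by (auto simp: r_def)
    then show "?h K \<le> \<epsilon> * (Sup K - Inf K)" using itv[OF *(1)] d(2)[of x] by auto
  qed
  \<comment> \<open>Restoring the omitted intervals adds nonnegative terms and makes the sum
    telescope.\<close>
  also have "\<dots> \<le> (\<Sum>(x, K)\<in>p. \<epsilon> * (Sup K - Inf K))"
  proof (rule sum_mono2[OF finp])
    fix q assume "q \<in> p - (p - r)"
    then obtain x K where q: "q = (x, K)" "(x, K) \<in> p" by (cases q) auto
    show "0 \<le> (case q of (x, K) \<Rightarrow> \<epsilon> * (Sup K - Inf K))" using itv[OF q(2)] \<epsilon> q(1) by auto
  qed auto
  also have "\<dots> = (\<Sum>(x, K)\<in>p. (\<lambda>t. \<epsilon> * t) (Sup K) - (\<lambda>t. \<epsilon> * t) (Inf K))"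
    by (simp add: right_diff_distrib)
  also have "\<dots> = \<epsilon> * b - \<epsilon> * a" by (rule additive_tagged_division_1[OF \<open>a \<le> b\<close> p])
  finally have 2: "(\<Sum>(x, K)\<in>p - r. ?h K) \<le> \<epsilon> * b - \<epsilon> * a" .
  have "f b - f a = (\<Sum>(x, K)\<in>p. ?h K)"
    by (rule additive_tagged_division_1[OF \<open>a \<le> b\<close> p, symmetric])
  also have "\<dots> = (\<Sum>(x, K)\<in>p - r. ?h K) + (\<Sum>(x, K)\<in>r. ?h K)"
    by (rule sum.subset_diff[OF rp finp])
  also have "\<dots> \<le> \<epsilon> * (b - a + 2 * M)" using 1 2 by (simp add: algebra_simps)
  also have "\<dots> \<le> \<epsilon> * (b - a + 1 + 2 * M)" using \<epsilon> by simp
  also have "\<dots> = e" using \<open>a \<le> b\<close> M by (simp add: \<epsilon>_def)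
  finally show "f b \<le> f a + e" by simp
qed

text \<open>This transfers absolute continuity to a linear image shifted by a Lipschitz motion. The
  two terms of the bound each receive half of \<open>\<epsilon>\<close>.\<close>

lemma absolutely_continuous_on_dominated:
  fixes y z :: "real \<Rightarrow> real^5"
  assumes y: "absolutely_continuous_on y S"
    and dom: "\<And>u v. u \<in> S \<Longrightarrow> v \<in> S \<Longrightarrow> norm (z u - z v) \<le> L * norm (y u - y v) + M * \<bar>u - v\<bar>"
  shows "absolutely_continuous_on z S"
  unfolding absolutely_continuous_on_def
proof (intro allI impI)
  fix \<epsilon> :: real assume "0 < \<epsilon>"
  define L' where "L' = max L 1"
  define M' where "M' = max M 1"
  have pos: "0 < L'" "0 < M'" "L \<le> L'" "M \<le> M'" by (auto simp: L'_def M'_def)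
  have "0 < \<epsilon> / (2 * L')" using \<open>0 < \<epsilon>\<close> pos by simp
  with y obtain \<delta> where \<delta>: "0 < \<delta>" "\<forall>\<D> T. \<D> division_of T \<and> T \<subseteq> S \<and> (\<Sum>K\<in>\<D>. Sup K - Inf K) < \<delta> \<longrightarrow>
      (\<Sum>K\<in>\<D>. norm (y (Sup K) - y (Inf K))) < \<epsilon> / (2 * L')"
    unfolding absolutely_continuous_on_def by blast
  show "\<exists>\<delta>>0. \<forall>\<D> T. \<D> division_of T \<and> T \<subseteq> S \<and> (\<Sum>K\<in>\<D>. Sup K - Inf K) < \<delta> \<longrightarrow>
        (\<Sum>K\<in>\<D>. norm (z (Sup K) - z (Inf K))) < \<epsilon>"
  proof (intro exI[of _ "min \<delta> (\<epsilon> / (2 * M'))"] conjI allI impI)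
    show "0 < min \<delta> (\<epsilon> / (2 * M'))" using \<delta>(1) \<open>0 < \<epsilon>\<close> pos by simp
  next
    fix \<D> :: "real set set" and T
    assume *: "\<D> division_of T \<and> T \<subseteq> S \<and> (\<Sum>K\<in>\<D>. Sup K - Inf K) < min \<delta> (\<epsilon> / (2 * M'))"
    then have small: "(\<Sum>K\<in>\<D>. norm (y (Sup K) - y (Inf K))) < \<epsilon> / (2 * L')"
      by (intro \<delta>(2)[rule_format]) auto
    have "(\<Sum>K\<in>\<D>. norm (z (Sup K) - z (Inf K))) \<le>
      (\<Sum>K\<in>\<D>. L' * norm (y (Sup K) - y (Inf K)) + M' * (Sup K - Inf K))"
    proof (rule sum_mono)
      fix K assume K: "K \<in> \<D>"
      then obtain u v where "K = cbox u v" "K \<noteq> {}" "K \<subseteq> S" using * division_ofD(2,3,4) by (metis order_trans)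
      then have uv: "Inf K = u" "Sup K = v" "u \<le> v" "u \<in> S" "v \<in> S" by auto
      have "norm (z v - z u) \<le> L * norm (y v - y u) + M * \<bar>v - u\<bar>" by (rule dom) (use uv in auto)
      also have "\<dots> \<le> L' * norm (y v - y u) + M' * \<bar>v - u\<bar>"
        using pos by (intro add_mono mult_right_mono) auto
      finally show "norm (z (Sup K) - z (Inf K)) \<le> L' * norm (y (Sup K) - y (Inf K)) + M' * (Sup K - Inf K)"
        using uv by simp
    qed
    also have "\<dots> = L' * (\<Sum>K\<in>\<D>. norm (y (Sup K) - y (Inf K))) + M' * (\<Sum>K\<in>\<D>. Sup K - Inf K)"
      by (simp add: sum.distrib sum_distrib_left)
    also have "\<dots> < \<epsilon> / 2 + \<epsilon> / 2"
    proof (rule add_strict_mono)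
      show "L' * (\<Sum>K\<in>\<D>. norm (y (Sup K) - y (Inf K))) < \<epsilon> / 2"
        using small pos by (simp add: pos_less_divide_eq mult.commute mult.left_commute)
      show "M' * (\<Sum>K\<in>\<D>. Sup K - Inf K) < \<epsilon> / 2"
        using * pos by (simp add: pos_less_divide_eq mult.commute mult.left_commute)
    qed
    finally show "(\<Sum>K\<in>\<D>. norm (z (Sup K) - z (Inf K))) < \<epsilon>" by simp
  qed
qed

subsection \<open>Constant drift in a convex set\<close>

text \<open>The squared distance is used because, unlike the distance, it is differentiable on
  \<open>F\<close> as well. Testing \<open>y\<close> against the projection of \<open>x\<close>
  bounds it from above; expanding a square and using the obtuse angle at the projection bounds it
  from below. The two bounds differ by the square of \<open>norm (y - x)\<close>.\<close>

lemma infdist_power2_has_derivative: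
  fixes F :: "'a::euclidean_space set"
  assumes F: "closed F" "convex F" "F \<noteq> {}"
  shows "((\<lambda>x. (infdist x F)\<^sup>2) has_derivative (\<lambda>h. 2 * ((x - closest_point F x) \<bullet> h))) (at x within S)"
proof (rule has_derivativeI_sandwich[where e=1 and H="\<lambda>y. norm (y - x)"])
  let ?p = "closest_point F"
  have dist_eq: "infdist y F = norm (y - ?p y)" for y
    using setdist_closest_point[OF F(1,3)] by (simp add: infdist_eq_setdist dist_norm)
  fix y :: 'a assume "y \<noteq> x"
  define v where "v = x - ?p x"
  define k where "k = y - x"
  have mem: "?p y \<in> F" using F by (simp add: closest_point_in_set)
  have xle: "v \<bullet> (?p y - ?p x) \<le> 0"
    unfolding v_def by (rule closest_point_dot) (use F mem in auto)
  have "infdist y F \<le> norm (v + k)"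
    using infdist_le[of "?p x" F y] F by (simp add: v_def k_def dist_norm closest_point_in_set)
  then have "(infdist y F)\<^sup>2 \<le> (norm (v + k))\<^sup>2"
    by (intro power_mono) (auto simp: infdist_nonneg)
  then have upper: "(infdist y F)\<^sup>2 \<le> (norm v)\<^sup>2 + 2 * (v \<bullet> k) + (norm k)\<^sup>2"
    by (simp add: power2_norm_eq_inner inner_simps inner_commute)
  have "0 \<le> (norm (y - ?p y - v))\<^sup>2" by simp
  also have "\<dots> = (norm (y - ?p y))\<^sup>2 - 2 * (v \<bullet> (y - ?p y)) + (norm v)\<^sup>2"
    by (simp add: power2_norm_eq_inner inner_simps inner_commute)
  also have "v \<bullet> (y - ?p y) = (norm v)\<^sup>2 + v \<bullet> k - v \<bullet> (?p y - ?p x)"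
    by (simp add: power2_norm_eq_inner v_def k_def inner_simps)
  finally have lower: "(norm v)\<^sup>2 + 2 * (v \<bullet> k) \<le> (infdist y F)\<^sup>2"
    using xle by (simp add: dist_eq)
  have "\<bar>(infdist y F)\<^sup>2 - (infdist x F)\<^sup>2 - 2 * (v \<bullet> k)\<bar> \<le> (norm k)\<^sup>2"
    using upper lower by (simp add: dist_eq[of x] v_def[symmetric])
  then show "norm ((infdist y F)\<^sup>2 - (infdist x F)\<^sup>2 - 2 * ((x - ?p x) \<bullet> (y - x))) / norm (y - x) \<le> norm (y - x)"
    using \<open>y \<noteq> x\<close> by (simp add: v_def k_def divide_le_eq power2_eq_square)
next
  show "((\<lambda>y. norm (y - x)) \<longlongrightarrow> 0) (at x within S)"
    by (rule tendsto_eq_intros refl | simp)+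
qed (auto intro!: bounded_linear_const_mult bounded_linear_inner_right)

lemma infdist_power2_has_derivative_along:
  fixes F :: "'a::euclidean_space set"
  assumes F: "closed F" "convex F" "F \<noteq> {}"
    and z: "(z has_vector_derivative z') (at t within S)"
  shows "((\<lambda>t. (infdist (z t) F)\<^sup>2) has_real_derivative 2 * ((z t - closest_point F (z t)) \<bullet> z')) (at t within S)"
proof -
  have "((\<lambda>t. (infdist (z t) F)\<^sup>2) has_derivative (\<lambda>h. 2 * ((z t - closest_point F (z t)) \<bullet> (h *\<^sub>R z')))) (at t within S)"
    using has_derivative_compose[OF z[unfolded has_vector_derivative_def] infdist_power2_has_derivative[OF F, of "z t" UNIV]] .
  then show ?thesis
    by (simp add: has_field_derivative_def mult.assoc mult.left_commute mult.commute[of "2 * _"] mult_commute_abs)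
qed

lemma infdist_power2_lipschitz:
  fixes C :: "'a::euclidean_space set"
  assumes "bounded C" "F \<noteq> {}"
  obtains L where "\<And>x y. x \<in> C \<Longrightarrow> y \<in> C \<Longrightarrow> \<bar>(infdist x F)\<^sup>2 - (infdist y F)\<^sup>2\<bar> \<le> L * norm (x - y)"
proof -
  obtain p where p: "p \<in> F" using assms by blast
  obtain B where B: "\<And>x. x \<in> C \<Longrightarrow> norm x \<le> B" using assms by (auto simp: bounded_iff)
  have bd: "infdist x F \<le> B + norm p" if "x \<in> C" for x
    using infdist_le[OF p, of x] norm_triangle_ineq4[of x p] B[OF that] by (simp add: dist_norm)
  show thesis
  proof (rule that[of "2 * (B + norm p)"])
    fix x y assume xy: "x \<in> C" "y \<in> C"
    have "\<bar>(infdist x F)\<^sup>2 - (infdist y F)\<^sup>2\<bar> = (infdist x F + infdist y F) * \<bar>infdist x F - infdist y F\<bar>"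
      by (simp add: power2_eq_square square_diff_square_factored abs_mult infdist_nonneg)
    also have "\<dots> \<le> (2 * (B + norm p)) * norm (x - y)"
    proof (rule mult_mono)
      show "infdist x F + infdist y F \<le> 2 * (B + norm p)" using bd[OF xy(1)] bd[OF xy(2)] by simp
      show "\<bar>infdist x F - infdist y F\<bar> \<le> norm (x - y)"
        using infdist_triangle_abs[of x F y] by (simp add: dist_norm)
      show "0 \<le> 2 * (B + norm p)" using order_trans[OF infdist_nonneg bd[OF xy(1)]] by simp
    qed simp
    finally show "\<bar>(infdist x F)\<^sup>2 - (infdist y F)\<^sup>2\<bar> \<le> 2 * (B + norm p) * norm (x - y)" .
  qed
qed

text \<open>Testing the variational inequality at the projection of \<open>z t\<close> to
  \<open>F\<close> and using \<open>sharp\<close> shows that the squared distance has derivative at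
  most \<open>- 2 * \<kappa> * infdist (z t) F\<close>. Hence the distance falls at rate at least
  \<open>\<kappa>\<close> while it is positive. With rate 0 the same argument applies to any closed
  convex nonempty part of \<open>F\<close>, in particular to the single point that is
  reached.\<close>

lemma constant_drift_reaches_face:
  fixes z :: "real \<Rightarrow> real^5"
  assumes ac: "\<And>a b. 0 \<le> a \<Longrightarrow> absolutely_continuous_on z {a..b}"
    and zC: "\<And>t. 0 \<le> t \<Longrightarrow> z t \<in> C" and C: "bounded C"
    and ae: "AE t in lebesgue. 0 \<le> t \<longrightarrow>
      (\<exists>z'. (z has_vector_derivative z') (at t within {0..}) \<and> (\<forall>\<xi>\<in>C. (g - z') \<bullet> (\<xi> - z t) \<le> 0))"
    and F: "F \<subseteq> C" "closed F" "convex F" "F \<noteq> {}" and \<kappa>: "0 < \<kappa>"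
    and sharp: "\<And>x w. x \<in> C \<Longrightarrow> w \<in> F \<Longrightarrow> \<kappa> * infdist x F \<le> g \<bullet> (w - x)"
    and \<tau>: "infdist (z 0) F \<le> \<kappa> * \<tau>"
  shows "\<exists>w\<in>F. \<forall>t\<ge>\<tau>. z t = w"
proof -
  define N where "N = {t. \<not> (0 \<le> t \<longrightarrow>
      (\<exists>z'. (z has_vector_derivative z') (at t within {0..}) \<and> (\<forall>\<xi>\<in>C. (g - z') \<bullet> (\<xi> - z t) \<le> 0)))}"
  have N: "negligible N"
    using ae unfolding N_def negligible_iff_null_sets by (simp add: completion.AE_iff_null_sets)
  have deriv: "\<exists>z'. (z has_vector_derivative z') (at t within S) \<and> (\<forall>\<xi>\<in>C. z' \<bullet> (z t - \<xi>) \<le> g \<bullet> (z t - \<xi>))"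
    if t: "0 \<le> t" "t \<notin> N" "S \<subseteq> {0..}" for t S
  proof -
    obtain z' where z': "(z has_vector_derivative z') (at t within {0..})"
        "\<forall>\<xi>\<in>C. (g - z') \<bullet> (\<xi> - z t) \<le> 0"
      using t(1,2) unfolding N_def by blast
    have "\<forall>\<xi>\<in>C. z' \<bullet> (z t - \<xi>) \<le> g \<bullet> (z t - \<xi>)"
    proof
      fix \<xi> assume "\<xi> \<in> C"
      with z'(2) have "(g - z') \<bullet> (\<xi> - z t) \<le> 0" by blast
      then show "z' \<bullet> (z t - \<xi>) \<le> g \<bullet> (z t - \<xi>)" by (simp add: inner_simps)
    qed
    with has_vector_derivative_within_subset[OF z'(1) t(3)] show ?thesis by blast
  qed
  \<comment> \<open>The rate \<open>\<kappa>\<close> is a fresh variable here: the estimate is used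
    with rate 0 for monotonicity and with the given rate for \<open>G = F\<close>.\<close>
  have sq_deriv: "\<exists>D \<le> - 2 * \<kappa> * infdist (z t) G. ((\<lambda>t. (infdist (z t) G)\<^sup>2) has_real_derivative D) (at t within S)"
    if G: "closed G" "convex G" "G \<noteq> {}" "G \<subseteq> F"
      and sharp_G: "\<And>x w. x \<in> C \<Longrightarrow> w \<in> G \<Longrightarrow> \<kappa> * infdist x G \<le> g \<bullet> (w - x)"
      and t: "0 \<le> t" "t \<notin> N" "S \<subseteq> {0..}" for G t S \<kappa>
  proof -
    let ?p = "closest_point G (z t)"
    obtain z' where z': "(z has_vector_derivative z') (at t within S)"
      "\<forall>\<xi>\<in>C. z' \<bullet> (z t - \<xi>) \<le> g \<bullet> (z t - \<xi>)" using deriv[OF t] by blast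
    have p: "?p \<in> G" using G by (simp add: closest_point_in_set)
    then have "z' \<bullet> (z t - ?p) \<le> g \<bullet> (z t - ?p)" using z'(2) F(1) G(4) by blast
    also have "\<dots> \<le> - \<kappa> * infdist (z t) G"
      using sharp_G[OF zC[OF t(1)] p] by (simp add: inner_simps)
    finally show ?thesis
      using infdist_power2_has_derivative_along[OF G(1-3) z'(1)]
      by (intro exI[of _ "2 * ((z t - ?p) \<bullet> z')"]) (auto simp: inner_commute)
  qed
  have decr: "(infdist (z b) G)\<^sup>2 \<le> (infdist (z a) G)\<^sup>2"
    if G: "closed G" "convex G" "G \<noteq> {}" "G \<subseteq> F" and ab: "0 \<le> a" "a \<le> b" for G a b
  proof -
    obtain L where L: "\<And>x y. x \<in> C \<Longrightarrow> y \<in> C \<Longrightarrow> \<bar>(infdist x G)\<^sup>2 - (infdist y G)\<^sup>2\<bar> \<le> L * norm (x - y)"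
      using infdist_power2_lipschitz[OF C G(3)] by blast
    have nonneg: "0 * infdist x G \<le> g \<bullet> (w - x)" if "x \<in> C" "w \<in> G" for x w
    proof -
      have "0 \<le> \<kappa> * infdist x F" using \<kappa> by (simp add: infdist_nonneg)
      then show ?thesis using sharp[OF that(1), of w] that G(4) by auto
    qed
    show ?thesis
    proof (rule absolutely_continuous_nonincreasing[OF ab(2) ac[OF ab(1)] _ N])
      fix u v assume "u \<in> {a..b}" "v \<in> {a..b}"
      then have "\<bar>(infdist (z u) G)\<^sup>2 - (infdist (z v) G)\<^sup>2\<bar> \<le> L * norm (z u - z v)"
        using L zC ab by simp
      also have "\<dots> \<le> max L 0 * (norm (z u - z v) + \<bar>u - v\<bar>)"
        by (rule mult_mono) auto
      finally show "\<bar>(infdist (z u) G)\<^sup>2 - (infdist (z v) G)\<^sup>2\<bar> \<le> max L 0 * (norm (z u - z v) + \<bar>u - v\<bar>)" .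
    next
      fix t assume "t \<in> {a..b} - N"
      then show "\<exists>D\<le>0. ((\<lambda>t. (infdist (z t) G)\<^sup>2) has_real_derivative D) (at t within {a..b})"
        using sq_deriv[OF G nonneg, of t "{a..b}"] ab by auto
    qed
  qed
  have \<tau>0: "0 \<le> \<tau>"
    using \<tau> \<kappa> infdist_nonneg[of "z 0" F] by (meson linorder_not_le mult_pos_neg order_trans)
  \<comment> \<open>If the distance were positive at \<open>\<tau>\<close>, monotonicity would make
    it positive on all of \<open>{0..\<tau>}\<close>. There it is differentiable almost everywhere
    as the root of its square, and adding \<open>\<kappa> * t\<close> gives a nonincreasing
    function, which contradicts the bound on the initial distance.\<close>
  have "infdist (z \<tau>) F = 0"
  proof (rule ccontr)
    assume "infdist (z \<tau>) F \<noteq> 0"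
    then have pos\<tau>: "0 < infdist (z \<tau>) F" using infdist_nonneg[of "z \<tau>" F] by linarith
    have pos: "0 < infdist (z t) F" if "0 \<le> t" "t \<le> \<tau>" for t
    proof -
      have "0 < (infdist (z t) F)\<^sup>2" using decr[OF F(2-4) order_refl that] pos\<tau> by (smt (verit) zero_less_power)
      then show ?thesis using infdist_nonneg[of "z t" F] by (cases "infdist (z t) F = 0") auto
    qed
    have "infdist (z \<tau>) F + \<kappa> * \<tau> \<le> infdist (z 0) F + \<kappa> * 0"
    proof (rule absolutely_continuous_nonincreasing[OF \<tau>0 ac[OF order_refl] _ N])
      fix u v
      have "\<bar>(infdist (z u) F + \<kappa> * u) - (infdist (z v) F + \<kappa> * v)\<bar> = \<bar>(infdist (z u) F - infdist (z v) F) + \<kappa> * (u - v)\<bar>"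
        by (simp add: algebra_simps)
      also have "\<dots> \<le> \<bar>infdist (z u) F - infdist (z v) F\<bar> + \<kappa> * \<bar>u - v\<bar>"
        using abs_triangle_ineq[of "infdist (z u) F - infdist (z v) F" "\<kappa> * (u - v)"] \<kappa> by (simp add: abs_mult)
      also have "\<dots> \<le> (1 + \<kappa>) * norm (z u - z v) + (1 + \<kappa>) * \<bar>u - v\<bar>"
      proof (rule add_mono)
        have "\<bar>infdist (z u) F - infdist (z v) F\<bar> \<le> 1 * norm (z u - z v)"
          using infdist_triangle_abs[of "z u" F "z v"] by (simp add: dist_norm)
        also have "\<dots> \<le> (1 + \<kappa>) * norm (z u - z v)" using \<kappa> by (intro mult_right_mono) auto
        finally show "\<bar>infdist (z u) F - infdist (z v) F\<bar> \<le> (1 + \<kappa>) * norm (z u - z v)" .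
      qed (intro mult_right_mono, auto)
      finally show "\<bar>(infdist (z u) F + \<kappa> * u) - (infdist (z v) F + \<kappa> * v)\<bar> \<le> (1 + \<kappa>) * (norm (z u - z v) + \<bar>u - v\<bar>)"
        by (simp add: distrib_left)
    next
      fix t assume t: "t \<in> {0..\<tau>} - N"
      then obtain D where D: "D \<le> - 2 * \<kappa> * infdist (z t) F"
        "((\<lambda>t. (infdist (z t) F)\<^sup>2) has_real_derivative D) (at t within {0..\<tau>})"
        using sq_deriv[OF F(2-4) order_refl sharp, of t "{0..\<tau>}"] by auto
      have post: "0 < infdist (z t) F" using pos t by auto
      have "((\<lambda>t. sqrt ((infdist (z t) F)\<^sup>2)) has_real_derivative inverse (sqrt ((infdist (z t) F)\<^sup>2)) / 2 * D) (at t within {0..\<tau>})"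
        using DERIV_chain2[OF DERIV_real_sqrt D(2)] post by simp
      then have "((\<lambda>t. infdist (z t) F + \<kappa> * t) has_real_derivative inverse (infdist (z t) F) / 2 * D + \<kappa>) (at t within {0..\<tau>})"
        by (auto intro!: derivative_eq_intros simp: infdist_nonneg)
      moreover have "inverse (infdist (z t) F) / 2 * D + \<kappa> \<le> 0"
        using D(1) post by (simp add: field_simps)
      ultimately show "\<exists>D\<le>0. ((\<lambda>t. infdist (z t) F + \<kappa> * t) has_real_derivative D) (at t within {0..\<tau>})" by blast
    qed
    then show False using pos\<tau> \<tau> by simp
  qed
  then have w: "z \<tau> \<in> F" using F by (simp add: in_closed_iff_infdist_zero)
  \<comment> \<open>Monotonicity for the singleton of the point reached: the distance from it starts
    at 0 and cannot grow.\<close>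
  have "z t = z \<tau>" if "\<tau> \<le> t" for t
    using decr[of "{z \<tau>}" \<tau> t] w \<tau>0 that by simp
  with w show ?thesis by blast
qed

subsection \<open>Geometry of the set of balanced stresses\<close>

text \<open>Equilibrium of forces at the two inner nodes, which describes \<open>V_space\<close> in
  terms of stresses.\<close>

definition balanced :: "real^5 \<Rightarrow> bool" where
  "balanced s \<longleftrightarrow> s$1 = s$3 + s$4 \<and> s$5 = s$2 + s$3"

text \<open>The square of \<open>norm_A\<close> of the elongation whose stress is
  \<open>s\<close>.\<close>

definition energy :: "real^5 \<Rightarrow> real^5 \<Rightarrow> real" where
  "energy a s = (\<Sum>i\<in>UNIV. (s$i)\<^sup>2 / a$i)"

definition admissible :: "(side \<Rightarrow> real^5) \<Rightarrow> real^5 \<Rightarrow> bool" where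
  "admissible cl s \<longleftrightarrow> balanced s \<and> (\<forall>i. within_limits cl i (s$i))"

text \<open>Cauchy-Schwarz in the form with denominators; the difference of the two sides is a
  square over a positive number.\<close>

lemma series_bound:
  fixes a b x y :: real
  assumes "0 < a" "0 < b"
  shows "(x + y)\<^sup>2 / (a + b) \<le> x\<^sup>2 / a + y\<^sup>2 / b"
proof -
  have "x\<^sup>2 / a + y\<^sup>2 / b - (x + y)\<^sup>2 / (a + b) = (b * x - a * y)\<^sup>2 / (a * b * (a + b))"
    using assms by (simp add: divide_simps) (simp add: algebra_simps power2_eq_square)
  also have "\<dots> \<ge> 0" using assms by simp
  finally show ?thesis by simp
qed

lemma energy_orthogonal:
  assumes "(\<Sum>i\<in>UNIV. x$i * y$i / a$i) = 0"
  shows "energy a (x + t *\<^sub>R y) = energy a x + t\<^sup>2 * energy a y"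
proof -
  have "energy a (x + t *\<^sub>R y) = (\<Sum>i\<in>UNIV. (x$i)\<^sup>2 / a$i + t\<^sup>2 * ((y$i)\<^sup>2 / a$i) + 2 * t * (x$i * y$i / a$i))"
    unfolding energy_def
    by (intro sum.cong) (simp_all add: power2_eq_square add_divide_distrib[symmetric] algebra_simps)
  also have "\<dots> = energy a x + t\<^sup>2 * energy a y + 2 * t * (\<Sum>i\<in>UNIV. x$i * y$i / a$i)"
    by (simp add: energy_def sum.distrib sum_distrib_left)
  finally show ?thesis using assms by simp
qed

text \<open>Here \<open>D\<close> is the perpendicular from the line \<open>w0 + \<theta> u\<close>
  to \<open>s\<close>, and coordinate \<open>k\<close> parametrises the line. Clamping
  \<open>\<theta>\<close> to the limits moves it by at most the size of \<open>D$k\<close>, because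
  \<open>s$k\<close> respects the limits. By Pythagoras it remains to bound \<open>D$k\<close>. The
  number \<open>N\<close> bounds the squared norm of the \<open>k\<close>-th coordinate functional;
  orthogonality of \<open>D\<close> and \<open>u\<close> sharpens this bound just enough to give the
  factor \<open>\<sigma>\<close>.\<close>

lemma segment_near_line:
  assumes a: "\<forall>i. 0 < a$i"
    and N: "\<And>X. balanced X \<Longrightarrow> (X$k)\<^sup>2 \<le> N * energy a X"
    and \<sigma>: "N * energy a u \<le> \<sigma>" "1 \<le> \<sigma>"
    and u: "balanced u" "u$k = 1"
    and D: "balanced D" "(\<Sum>i\<in>UNIV. D$i * u$i / a$i) = 0"
    and lim: "lo \<le> s$k" "s$k \<le> hi"
    and s: "s = w0 + \<theta> *\<^sub>R u + D" "w0$k = 0"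
  shows "\<exists>w\<in>closed_segment (w0 + lo *\<^sub>R u) (w0 + hi *\<^sub>R u). energy a (s - w) \<le> \<sigma> * energy a D"
proof
  define \<theta>' where "\<theta>' = max lo (min hi \<theta>)"
  have sk: "s$k = \<theta> + D$k" using s u by simp
  have "\<bar>\<theta> - \<theta>'\<bar> \<le> \<bar>D$k\<bar>" using lim sk by (auto simp: \<theta>'_def)
  then have dist: "(\<theta> - \<theta>')\<^sup>2 \<le> (D$k)\<^sup>2" by (simp add: abs_le_square_iff)
  have nonneg: "0 \<le> energy a X" for X
    using a by (auto simp: energy_def less_imp_le intro!: sum_nonneg)
  have "0 < (u$k)\<^sup>2 / a$k" using a u by simp
  also have "\<dots> \<le> energy a u"
    unfolding energy_def using a by (intro member_le_sum) (auto simp: less_imp_le)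
  finally have U: "0 < energy a u" .
  have key: "energy a D + (D$k)\<^sup>2 * energy a u \<le> \<sigma> * energy a D"
  proof (cases "D$k = 0")
    case True
    then show ?thesis using \<sigma>(2) nonneg[of D] mult_right_mono[of 1 \<sigma> "energy a D"] by simp
  next
    case False
    \<comment> \<open>The bound \<open>N\<close> is applied to the vector \<open>D + t u\<close> that realises equality in the Cauchy-Schwarz inequality.\<close>
    define t where "t = energy a D / (energy a u * D$k)"
    have "balanced (D + t *\<^sub>R u)" using D(1) u(1) by (simp add: balanced_def algebra_simps)
    then have "(D$k + t)\<^sup>2 \<le> N * (energy a D + t\<^sup>2 * energy a u)"
      using N[of "D + t *\<^sub>R u"] u(2) by (simp add: energy_orthogonal[OF D(2)])
    \<comment> \<open>Clearing the denominator of \<open>t\<close> makes both sides multiples of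
      \<open>energy a D + (D$k)\<^sup>2 * energy a u\<close>, and one such factor cancels.\<close>
    then have "(energy a u * D$k)\<^sup>2 * (D$k + t)\<^sup>2 \<le> (energy a u * D$k)\<^sup>2 * (N * (energy a D + t\<^sup>2 * energy a u))"
      by (rule mult_left_mono) simp
    also have "(energy a u * D$k)\<^sup>2 * (D$k + t)\<^sup>2 = ((D$k)\<^sup>2 * energy a u + energy a D)\<^sup>2"
      using False U by (simp add: t_def power_mult_distrib[symmetric] distrib_left power2_eq_square[of "D$k"] ac_simps)
    also have "(energy a u * D$k)\<^sup>2 * (N * (energy a D + t\<^sup>2 * energy a u)) =
        N * energy a u * energy a D * ((D$k)\<^sup>2 * energy a u + energy a D)"
      using False U by (simp add: t_def power2_eq_square field_simps)
    finally have "(energy a D + (D$k)\<^sup>2 * energy a u) * (energy a D + (D$k)\<^sup>2 * energy a u) \<le>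
        (N * energy a u * energy a D) * (energy a D + (D$k)\<^sup>2 * energy a u)"
      by (simp add: power2_eq_square add.commute)
    moreover have "0 < energy a D + (D$k)\<^sup>2 * energy a u" using False U nonneg[of D] by (simp add: add_nonneg_pos)
    ultimately have "energy a D + (D$k)\<^sup>2 * energy a u \<le> N * energy a u * energy a D"
      by (simp only: mult_le_cancel_right)
    also have "\<dots> \<le> \<sigma> * energy a D" using \<sigma>(1) nonneg by (rule mult_right_mono)
    finally show ?thesis .
  qed
  have "s - (w0 + \<theta>' *\<^sub>R u) = D + (\<theta> - \<theta>') *\<^sub>R u" unfolding s by (simp add: algebra_simps)
  then have "energy a (s - (w0 + \<theta>' *\<^sub>R u)) = energy a D + (\<theta> - \<theta>')\<^sup>2 * energy a u"
    by (simp add: energy_orthogonal[OF D(2)])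
  also have "\<dots> \<le> energy a D + (D$k)\<^sup>2 * energy a u"
    using dist U by (simp add: mult_right_mono)
  finally show "energy a (s - (w0 + \<theta>' *\<^sub>R u)) \<le> \<sigma> * energy a D" using key by simp
  have "\<theta>' \<in> closed_segment lo hi"
    using lim by (auto simp: closed_segment_eq_real_ivl \<theta>'_def)
  then obtain x where x: "0 \<le> x" "x \<le> 1" "\<theta>' = (1 - x) * lo + x * hi" by (auto simp: closed_segment_def)
  have "w0 + \<theta>' *\<^sub>R u = (1 - x) *\<^sub>R (w0 + lo *\<^sub>R u) + x *\<^sub>R (w0 + hi *\<^sub>R u)"
    unfolding x(3) by (simp add: algebra_simps)
  then show "w0 + \<theta>' *\<^sub>R u \<in> closed_segment (w0 + lo *\<^sub>R u) (w0 + hi *\<^sub>R u)"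
    unfolding closed_segment_def using x(1,2) by blast
qed

section \<open>Explicit energy bounds for the network\<close>

lemma energy_5: "energy a s = (s$1)\<^sup>2 / a$1 + (s$2)\<^sup>2 / a$2 + (s$3)\<^sup>2 / a$3 + (s$4)\<^sup>2 / a$4 + (s$5)\<^sup>2 / a$5"
  by (simp add: energy_def sum_5)

text \<open>The square of the function h without its factor \<open>l\<^sub>1\<close>. For positive
  arguments its reciprocal is the compliance \<open>1 / x + (a3 + y) / q\<close>.\<close>

definition H_of :: "real \<Rightarrow> real \<Rightarrow> real \<Rightarrow> real \<Rightarrow> real" where
  "H_of q x a3 y = x * q / (x * (a3 + y) + q)"

text \<open>With this \<open>r\<close> the energy is a quadratic form in \<open>p1\<close> and
  \<open>p2\<close> whose diagonal coefficients \<open>\<alpha>\<close> and \<open>\<gamma>\<close>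
  are the reciprocals of the two values of \<open>H_of\<close>. Its mixed coefficient
  \<open>a3 / Q\<close> is at most the larger of them, so for nonnegative \<open>p1\<close>,
  \<open>p2\<close> the form is at most that maximum times the square of the sum.\<close>

lemma line_energy_bound:
  fixes a1 a2 a3 a4 a5 p1 p2 :: real
  assumes pos: "0 < a1" "0 < a2" "0 < a3" "0 < a4" "0 < a5" and p: "0 \<le> p1" "0 \<le> p2"
    and Q: "Q = a4 * a5 + a3 * (a4 + a5)" and r: "r = a3 * (a4 * p2 - a5 * p1) / Q"
  shows "min (H_of Q a2 a3 a4) (H_of Q a1 a3 a5) *
    (p1\<^sup>2 / a1 + p2\<^sup>2 / a2 + r\<^sup>2 / a3 + (p1 + r)\<^sup>2 / a4 + (r - p2)\<^sup>2 / a5) \<le> (p1 + p2)\<^sup>2"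
proof -
  define \<alpha> where "\<alpha> = 1 / a1 + (a3 + a5) / Q"
  define \<gamma> where "\<gamma> = 1 / a2 + (a3 + a4) / Q"
  have Qpos: "0 < Q" unfolding Q using pos by (intro add_pos_pos mult_pos_pos)
  have \<alpha>: "H_of Q a1 a3 a5 = 1 / \<alpha>" and \<gamma>: "H_of Q a2 a3 a4 = 1 / \<gamma>"
    using pos Qpos by (simp_all add: H_of_def \<alpha>_def \<gamma>_def field_simps)
  have \<alpha>\<gamma>: "0 < \<alpha>" "0 < \<gamma>" using pos Qpos by (simp_all add: \<alpha>_def \<gamma>_def add_pos_pos)
  have \<beta>: "a3 / Q \<le> max \<alpha> \<gamma>"
  proof -
    have "a3 / Q \<le> (a3 + a5) / Q" using pos Qpos by (simp add: divide_right_mono)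
    also have "\<dots> \<le> \<alpha>" using pos by (simp add: \<alpha>_def)
    finally show ?thesis by simp
  qed
  have "r = (a3 * a4 * p2 - a3 * a5 * p1) / Q" using r by (simp add: algebra_simps)
  moreover have "p1 + r = a4 * (p1 * (a3 + a5) + a3 * p2) / Q"
    using Qpos unfolding r by (simp add: field_simps) (simp add: Q algebra_simps)
  moreover have "r - p2 = - a5 * (p2 * (a3 + a4) + a3 * p1) / Q"
    using Qpos unfolding r by (simp add: field_simps) (simp add: Q algebra_simps)
  ultimately have "r\<^sup>2 / a3 + (p1 + r)\<^sup>2 / a4 + (r - p2)\<^sup>2 / a5 =
      (a3 * (a4 * p2 - a5 * p1)\<^sup>2 + a4 * (p1 * (a3 + a5) + a3 * p2)\<^sup>2 + a5 * (p2 * (a3 + a4) + a3 * p1)\<^sup>2) / Q\<^sup>2"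
    using pos by (simp add: power_divide power_mult_distrib add_divide_distrib r power2_eq_square ac_simps)
  \<comment> \<open>The numerator contains the factor \<open>Q\<close>, which reduces the
    denominator to the first power.\<close>
  also have "\<dots> = ((a5 * p1\<^sup>2 + a4 * p2\<^sup>2 + a3 * (p1 + p2)\<^sup>2) * Q) / Q\<^sup>2"
    by (rule arg_cong[where f = "\<lambda>x. x / _"]) (simp add: Q power2_eq_square algebra_simps)
  also have "\<dots> = (a5 * p1\<^sup>2 + a4 * p2\<^sup>2 + a3 * (p1 + p2)\<^sup>2) / Q"
    using Qpos by (simp add: power2_eq_square)
  finally have "p1\<^sup>2 / a1 + p2\<^sup>2 / a2 + r\<^sup>2 / a3 + (p1 + r)\<^sup>2 / a4 + (r - p2)\<^sup>2 / a5 =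
      p1\<^sup>2 / a1 + p2\<^sup>2 / a2 + (a5 * p1\<^sup>2 + a4 * p2\<^sup>2 + a3 * (p1 + p2)\<^sup>2) / Q" by simp
  also have "\<dots> = \<alpha> * p1\<^sup>2 + 2 * (a3 / Q) * (p1 * p2) + \<gamma> * p2\<^sup>2"
    by (simp add: \<alpha>_def \<gamma>_def power2_eq_square add_divide_distrib algebra_simps)
  also have "\<dots> \<le> max \<alpha> \<gamma> * p1\<^sup>2 + 2 * max \<alpha> \<gamma> * (p1 * p2) + max \<alpha> \<gamma> * p2\<^sup>2"
    using p \<beta> by (intro add_mono mult_right_mono mult_left_mono) auto
  also have "\<dots> = max \<alpha> \<gamma> * (p1 + p2)\<^sup>2" by (simp add: power2_eq_square algebra_simps)
  finally have le: "p1\<^sup>2 / a1 + p2\<^sup>2 / a2 + r\<^sup>2 / a3 + (p1 + r)\<^sup>2 / a4 + (r - p2)\<^sup>2 / a5 \<le> max \<alpha> \<gamma> * (p1 + p2)\<^sup>2" .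
  have m: "min (H_of Q a2 a3 a4) (H_of Q a1 a3 a5) = 1 / max \<alpha> \<gamma>"
    unfolding \<alpha> \<gamma> using \<alpha>\<gamma> by (auto simp: min_def max_def field_simps)
  show ?thesis
    unfolding m using le \<alpha>\<gamma> by (simp add: divide_le_eq mult.commute max_def split: if_splits)
qed

text \<open>Each bound eliminates the other springs by repeated use of \<open>series_bound\<close>:
  for a given stress in one spring, the rest of the network stores at least the energy of a single
  spring of effective stiffness. Adding the two compliances gives \<open>E_of a\<close> over the
  stated product. The pairs used first are springs 1 and 4, whose stresses differ by
  \<open>X$3\<close>, and springs 2 and 5, likewise.\<close>

lemma component_bounds:
  assumes a: "\<forall>i. 0 < a$i" and X: "balanced X"
  shows "(X$3)\<^sup>2 \<le> a$3 * ((a$1 + a$4) * (a$2 + a$5)) / E_of a * energy a X"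
    and "(X$4)\<^sup>2 \<le> a$4 * (a$3 * (a$2 + a$5) + a$1 * (a$2 + a$3 + a$5)) / E_of a * energy a X"
    and "(X$5)\<^sup>2 \<le> a$5 * (a$1 * (a$2 + a$3) + a$3 * a$4 + a$2 * (a$3 + a$4)) / E_of a * energy a X"
proof -
  have pos: "0 < a$1" "0 < a$2" "0 < a$3" "0 < a$4" "0 < a$5" using a by auto
  have E: "0 < E_of a" unfolding E_of_def using pos by (intro add_pos_pos mult_pos_pos)
  have s14: "(X$3)\<^sup>2 / (a$1 + a$4) \<le> (X$1)\<^sup>2 / a$1 + (X$4)\<^sup>2 / a$4"
    using series_bound[of "a$1" "a$4" "X$1" "- X$4"] pos X by (simp add: balanced_def)
  have s25: "(X$3)\<^sup>2 / (a$2 + a$5) \<le> (X$2)\<^sup>2 / a$2 + (X$5)\<^sup>2 / a$5"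
    using series_bound[of "a$2" "a$5" "- X$2" "X$5"] pos X by (simp add: balanced_def)
  have conv: "x \<le> m / E_of a * e" if "x * (1 / c + d) \<le> e" "1 / c + d = E_of a / m" "0 < m" for x m e c d
  proof -
    have "x * (E_of a / m) \<le> e" using that(1) unfolding that(2) .
    then show ?thesis using E that(3) by (simp add: field_simps)
  qed
  have frac: "1 / c + d / m = (m + c * d) / (c * m)" if "0 < c" "0 < m" for c d m :: real
    using that by (simp add: field_simps)
  show "(X$3)\<^sup>2 \<le> a$3 * ((a$1 + a$4) * (a$2 + a$5)) / E_of a * energy a X"
  proof (rule conv[where c = "a$3" and d = "1 / (a$1 + a$4) + 1 / (a$2 + a$5)"])
    show "(X$3)\<^sup>2 * (1 / a$3 + (1 / (a$1 + a$4) + 1 / (a$2 + a$5))) \<le> energy a X"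
      using s14 s25 by (simp add: energy_5 distrib_left)
    show "1 / a$3 + (1 / (a$1 + a$4) + 1 / (a$2 + a$5)) = E_of a / (a$3 * ((a$1 + a$4) * (a$2 + a$5)))"
      using pos by (simp add: divide_simps add_pos_pos less_imp_neq[THEN not_sym]) (simp add: E_of_def algebra_simps)
  qed (use pos in simp)
  show "(X$4)\<^sup>2 \<le> a$4 * (a$3 * (a$2 + a$5) + a$1 * (a$2 + a$3 + a$5)) / E_of a * energy a X"
  proof (rule conv[where c = "a$4"])
    let ?M = "a$3 * (a$2 + a$5) + a$1 * (a$2 + a$3 + a$5)"
    \<comment> \<open>The effective stiffness of springs 2, 3 and 5 as seen through
      \<open>X$3\<close>: its reciprocal is \<open>1 / a$3 + 1 / (a$2 + a$5)\<close>. For spring 5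
      below, springs 1 and 4 take the place of 2 and 5.\<close>
    define R where "R = a$3 * (a$2 + a$5) / (a$2 + a$3 + a$5)"
    have R: "0 < R" using pos by (simp add: R_def)
    have M: "0 < ?M" using pos by (simp add: add_pos_pos)
    have "(X$3)\<^sup>2 / R = (X$3)\<^sup>2 / a$3 + (X$3)\<^sup>2 / (a$2 + a$5)"
      using pos by (simp add: R_def divide_simps add_pos_pos less_imp_neq[THEN not_sym]) (simp add: algebra_simps)
    then have "(X$4)\<^sup>2 / (a$1 + R) \<le> (X$1)\<^sup>2 / a$1 + ((X$3)\<^sup>2 / a$3 + (X$3)\<^sup>2 / (a$2 + a$5))"
      using series_bound[of "a$1" R "X$1" "- X$3"] pos X R by (simp add: balanced_def)
    then show "(X$4)\<^sup>2 * (1 / a$4 + 1 / (a$1 + R)) \<le> energy a X"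
      using s25 by (simp add: energy_5 distrib_left)
    have "a$1 + R = ?M / (a$2 + a$3 + a$5)"
      using pos by (simp add: R_def field_simps)
    then have "1 / a$4 + 1 / (a$1 + R) = 1 / a$4 + (a$2 + a$3 + a$5) / ?M" by simp
    also have "\<dots> = (?M + a$4 * (a$2 + a$3 + a$5)) / (a$4 * ?M)" using M pos by (intro frac)
    also have "?M + a$4 * (a$2 + a$3 + a$5) = E_of a" by (simp add: E_of_def algebra_simps)
    finally show "1 / a$4 + 1 / (a$1 + R) = E_of a / (a$4 * ?M)" .
    show "0 < a$4 * ?M" using pos M by simp
  qed
  show "(X$5)\<^sup>2 \<le> a$5 * (a$1 * (a$2 + a$3) + a$3 * a$4 + a$2 * (a$3 + a$4)) / E_of a * energy a X"
  proof (rule conv[where c = "a$5"])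
    let ?M = "a$1 * (a$2 + a$3) + a$3 * a$4 + a$2 * (a$3 + a$4)"
    define R where "R = a$3 * (a$1 + a$4) / (a$1 + a$3 + a$4)"
    have R: "0 < R" using pos by (simp add: R_def)
    have M: "0 < ?M" using pos by (simp add: add_pos_pos)
    have "(X$3)\<^sup>2 / R = (X$3)\<^sup>2 / a$3 + (X$3)\<^sup>2 / (a$1 + a$4)"
      using pos by (simp add: R_def divide_simps add_pos_pos less_imp_neq[THEN not_sym]) (simp add: algebra_simps)
    then have "(X$5)\<^sup>2 / (a$2 + R) \<le> (X$2)\<^sup>2 / a$2 + ((X$3)\<^sup>2 / a$3 + (X$3)\<^sup>2 / (a$1 + a$4))"
      using series_bound[of "a$2" R "X$2" "X$3"] pos X R by (simp add: balanced_def)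
    then show "(X$5)\<^sup>2 * (1 / a$5 + 1 / (a$2 + R)) \<le> energy a X"
      using s14 by (simp add: energy_5 distrib_left)
    have "a$2 + R = ?M / (a$1 + a$3 + a$4)"
      using pos by (simp add: R_def field_simps)
    then have "1 / a$5 + 1 / (a$2 + R) = 1 / a$5 + (a$1 + a$3 + a$4) / ?M" by simp
    also have "\<dots> = (?M + a$5 * (a$1 + a$3 + a$4)) / (a$5 * ?M)" using M pos by (intro frac)
    also have "?M + a$5 * (a$1 + a$3 + a$4) = E_of a" by (simp add: E_of_def algebra_simps)
    finally show "1 / a$5 + 1 / (a$2 + R) = E_of a / (a$5 * ?M)" .
    show "0 < a$5 * ?M" using pos M by simp
  qed
qed

text \<open>The vector \<open>u\<close> spans the balanced stresses that vanish on springs 1 and 2.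
  The perpendicular \<open>D\<close> to the line is controlled by the deficits of springs 1 and 2
  through \<open>line_energy_bound\<close>, and \<open>segment_near_line\<close> passes from the
  line to the segment at the price of \<open>\<sigma>\<close>.\<close>

lemma upper_face_bound:
  assumes a: "\<forall>i. 0 < a$i" and s: "admissible cl s"
    and N: "\<And>X. balanced X \<Longrightarrow> (X$k)\<^sup>2 \<le> N * energy a X"
    and \<sigma>: "N * energy a u \<le> \<sigma>" "1 \<le> \<sigma>"
    and u: "balanced u" "u$1 = 0" "u$2 = 0" "u$k = 1"
    and w0: "balanced w0" "w0$1 = cl Plus $ 1" "w0$2 = cl Plus $ 2" "w0$k = 0"
  shows "\<exists>w\<in>closed_segment (w0 + cl Minus $ k *\<^sub>R u) (w0 + cl Plus $ k *\<^sub>R u).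
    min (H_of (Q_of a) (a$2) (a$3) (a$4)) (H_of (Q_of a) (a$1) (a$3) (a$5)) * energy a (s - w)
      \<le> \<sigma> * (cl Plus $ 1 + cl Plus $ 2 - s$1 - s$2)\<^sup>2"
proof -
  have pos: "0 < a$1" "0 < a$2" "0 < a$3" "0 < a$4" "0 < a$5" using a by auto
  define p1 where "p1 = cl Plus $ 1 - s$1"
  define p2 where "p2 = cl Plus $ 2 - s$2"
  have p: "0 \<le> p1" "0 \<le> p2" using s by (auto simp: admissible_def within_limits_def p1_def p2_def)
  have bal: "balanced s" using s by (simp add: admissible_def)
  have Qpos: "0 < Q_of a" unfolding Q_of_def using pos by (intro add_pos_pos mult_pos_pos)
  \<comment> \<open>The solution of \<open>r / a$3 + (p1 + r) / a$4 + (r - p2) / a$5 = 0\<close>,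
    which says that \<open>D\<close> is orthogonal to \<open>u\<close>.\<close>
  define r where "r = a$3 * (a$4 * p2 - a$5 * p1) / Q_of a"
  define D :: "real^5" where "D = vector [- p1, - p2, r, - (p1 + r), r - p2]"
  have balD: "balanced D" by (simp add: balanced_def D_def)
  have u45: "u$4 = - u$3" "u$5 = u$3" using u by (simp_all add: balanced_def)
  have rQ: "r * Q_of a = a$3 * (a$4 * p2 - a$5 * p1)" using Qpos by (simp add: r_def)
  have "r / a$3 + (p1 + r) / a$4 + (r - p2) / a$5 = (r * Q_of a - a$3 * (a$4 * p2 - a$5 * p1)) / (a$3 * a$4 * a$5)"
    using pos by (simp add: field_simps Q_of_def)
  then have "r / a$3 + (p1 + r) / a$4 + (r - p2) / a$5 = 0" by (simp add: rQ)
  then have "u$3 * (r / a$3 + (p1 + r) / a$4 + (r - p2) / a$5) = 0" by simp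
  then have orth: "(\<Sum>i\<in>UNIV. D$i * u$i / a$i) = 0"
    by (simp add: sum_5 D_def u u45 algebra_simps)
  \<comment> \<open>The difference is balanced and vanishes on springs 1 and 2, so it is a multiple
    of \<open>u\<close>; the factor is read off at \<open>k\<close>, where \<open>u\<close> is
    1.\<close>
  define \<theta> where "\<theta> = (s - w0 - D)$k"
  have "(s - w0 - D)$i = \<theta> * u$i" for i
    using exhaust_5[of i] exhaust_5[of k] bal w0 balD u u45
    by (auto simp: \<theta>_def balanced_def D_def p1_def p2_def algebra_simps)
  then have "s - w0 - D = \<theta> *\<^sub>R u" by (simp add: vec_eq_iff)
  then have seq: "s = w0 + \<theta> *\<^sub>R u + D" by (simp add: algebra_simps)
  have lim: "cl Minus $ k \<le> s$k" "s$k \<le> cl Plus $ k"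
    using s by (auto simp: admissible_def within_limits_def)
  obtain w where w: "w \<in> closed_segment (w0 + cl Minus $ k *\<^sub>R u) (w0 + cl Plus $ k *\<^sub>R u)"
    "energy a (s - w) \<le> \<sigma> * energy a D"
    using segment_near_line[OF a N \<sigma> u(1,4) balD orth lim seq w0(4)] by blast
  let ?H = "min (H_of (Q_of a) (a$2) (a$3) (a$4)) (H_of (Q_of a) (a$1) (a$3) (a$5))"
  have H: "0 \<le> ?H" using pos Qpos by (simp add: H_of_def)
  have "?H * energy a (s - w) \<le> ?H * (\<sigma> * energy a D)" using w(2) H by (rule mult_left_mono)
  also have "\<dots> = \<sigma> * (?H * energy a D)" by simp
  finally have 1: "?H * energy a (s - w) \<le> \<sigma> * (?H * energy a D)" .
  have "energy a D = p1\<^sup>2 / a$1 + p2\<^sup>2 / a$2 + r\<^sup>2 / a$3 + (p1 + r)\<^sup>2 / a$4 + (r - p2)\<^sup>2 / a$5"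
    unfolding energy_5 D_def by (simp del: minus_add_distrib)
  then have "?H * energy a D \<le> (p1 + p2)\<^sup>2"
    using line_energy_bound[OF pos p Q_of_def r_def] by simp
  then have "\<sigma> * (?H * energy a D) \<le> \<sigma> * (p1 + p2)\<^sup>2" using \<sigma>(2) by (intro mult_left_mono) auto
  with 1 have "?H * energy a (s - w) \<le> \<sigma> * (p1 + p2)\<^sup>2" by simp
  moreover have "p1 + p2 = cl Plus $ 1 + cl Plus $ 2 - s$1 - s$2" by (simp add: p1_def p2_def)
  ultimately show ?thesis using w(1) by metis
qed

lemma vec_eq_5: "x = y \<longleftrightarrow> x$1 = y$1 \<and> x$2 = y$2 \<and> x$3 = y$3 \<and> x$4 = y$4 \<and> x$5 = y$5" for x y :: "real^5"
  by (simp add: vec_eq_iff forall_5)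

lemma sigma_of_ge_1: "1 \<le> sigma_of sc a"
  by (cases sc) auto

text \<open>The scenarios differ in the spring \<open>k\<close> that limits the segment: 3, 4 or 5.
  The direction \<open>u\<close> is normalised at that spring, hence its sign change in scenario 2.
  The bound of the \<open>k\<close>-th component times \<open>energy a u\<close> is the fraction
  inside \<open>sigma_of\<close>.\<close>

lemma upper_scenarios_bound:
  assumes a: "\<forall>i. 0 < a$i" and s: "admissible cl s" and sc: "sc \<in> {Scenario1, Scenario2, Scenario3}"
  shows "\<exists>w\<in>closed_segment (Ay_star sc cl Minus) (Ay_star sc cl Plus).
    min (H_of (Q_of a) (a$2) (a$3) (a$4)) (H_of (Q_of a) (a$1) (a$3) (a$5)) * energy a (s - w)
      \<le> sigma_of sc a * (cl Plus $ 1 + cl Plus $ 2 - s$1 - s$2)\<^sup>2"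
proof -
  have pos: "0 < a$1" "0 < a$2" "0 < a$3" "0 < a$4" "0 < a$5" using a by auto
  have E: "0 < E_of a" unfolding E_of_def using pos by (intro add_pos_pos mult_pos_pos)
  have U: "1 / a$3 + 1 / a$4 + 1 / a$5 = Q_of a / (a$3 * a$4 * a$5)"
    using pos by (simp add: field_simps Q_of_def)
  consider "sc = Scenario1" | "sc = Scenario2" | "sc = Scenario3" using sc by blast
  then show ?thesis
  proof cases
    case 1
    define u :: "real^5" where "u = vector [0, 0, 1, -1, 1]"
    define w0 :: "real^5" where "w0 = vector [cl Plus $ 1, cl Plus $ 2, 0, cl Plus $ 1, cl Plus $ 2]"
    have seg: "Ay_star sc cl \<theta> = w0 + cl \<theta> $ 3 *\<^sub>R u" for \<theta>
      by (simp add: 1 vec_eq_5 u_def w0_def)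
    have "energy a u = Q_of a / (a$3 * a$4 * a$5)" by (simp add: energy_5 u_def U)
    then have "a$3 * ((a$1 + a$4) * (a$2 + a$5)) / E_of a * energy a u = (a$1 + a$4) * (a$2 + a$5) * Q_of a / (a$4 * a$5 * E_of a)"
      using pos by (simp add: ac_simps)
    then have "a$3 * ((a$1 + a$4) * (a$2 + a$5)) / E_of a * energy a u \<le> sigma_of sc a"
      by (simp add: 1)
    from upper_face_bound[OF a s component_bounds(1)[OF a] this, of w0] show ?thesis
      unfolding seg by (simp add: sigma_of_ge_1 balanced_def u_def w0_def)
  next
    case 2
    define u :: "real^5" where "u = vector [0, 0, -1, 1, -1]"
    define w0 :: "real^5" where "w0 = vector [cl Plus $ 1, cl Plus $ 2, cl Plus $ 1, 0, cl Plus $ 1 + cl Plus $ 2]"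
    have seg: "Ay_star sc cl \<theta> = w0 + cl \<theta> $ 4 *\<^sub>R u" for \<theta>
      by (simp add: 2 vec_eq_5 u_def w0_def)
    have "energy a u = Q_of a / (a$3 * a$4 * a$5)" by (simp add: energy_5 u_def U)
    then have "a$4 * (a$3 * (a$2 + a$5) + a$1 * (a$2 + a$3 + a$5)) / E_of a * energy a u = (a$3 * (a$2 + a$5) + a$1 * (a$2 + a$3 + a$5)) * Q_of a / (a$3 * a$5 * E_of a)"
      using pos by (simp add: ac_simps)
    then have "a$4 * (a$3 * (a$2 + a$5) + a$1 * (a$2 + a$3 + a$5)) / E_of a * energy a u \<le> sigma_of sc a"
      by (simp add: 2)
    from upper_face_bound[OF a s component_bounds(2)[OF a] this, of w0] show ?thesis
      unfolding seg by (simp add: sigma_of_ge_1 balanced_def u_def w0_def)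
  next
    case 3
    define u :: "real^5" where "u = vector [0, 0, 1, -1, 1]"
    define w0 :: "real^5" where "w0 = vector [cl Plus $ 1, cl Plus $ 2, - cl Plus $ 2, cl Plus $ 1 + cl Plus $ 2, 0]"
    have seg: "Ay_star sc cl \<theta> = w0 + cl \<theta> $ 5 *\<^sub>R u" for \<theta>
      by (simp add: 3 vec_eq_5 u_def w0_def)
    have "energy a u = Q_of a / (a$3 * a$4 * a$5)" by (simp add: energy_5 u_def U)
    then have "a$5 * (a$1 * (a$2 + a$3) + a$3 * a$4 + a$2 * (a$3 + a$4)) / E_of a * energy a u = (a$1 * (a$2 + a$3) + a$3 * a$4 + a$2 * (a$3 + a$4)) * Q_of a / (a$3 * a$4 * E_of a)"
      using pos by (simp add: ac_simps)
    then have "a$5 * (a$1 * (a$2 + a$3) + a$3 * a$4 + a$2 * (a$3 + a$4)) / E_of a * energy a u \<le> sigma_of sc a"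
      by (simp add: 3)
    from upper_face_bound[OF a s component_bounds(3)[OF a] this, of w0] show ?thesis
      unfolding seg by (simp add: sigma_of_ge_1 balanced_def u_def w0_def)
  qed
qed

text \<open>Exchanging the two loaded nodes reverses the order of the springs and swaps the upper
  scenarios 1, 2, 3 with the lower scenarios 6, 5, 4.\<close>

definition reflect :: "real^5 \<Rightarrow> real^5" where
  "reflect s = vector [s$5, s$4, s$3, s$2, s$1]"

lemma reflect_component [simp]:
  "reflect s $ 1 = s$5" "reflect s $ 2 = s$4" "reflect s $ 3 = s$3" "reflect s $ 4 = s$2" "reflect s $ 5 = s$1"
  by (simp_all add: reflect_def)

lemma linear_reflect: "linear reflect"
  by (rule linearI) (simp_all add: vec_eq_5)

fun dual :: "scenario \<Rightarrow> scenario" where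
  "dual Scenario1 = Scenario6"
| "dual Scenario2 = Scenario5"
| "dual Scenario3 = Scenario4"
| "dual Scenario4 = Scenario3"
| "dual Scenario5 = Scenario2"
| "dual Scenario6 = Scenario1"

text \<open>The upper bound is applied to the reflected network. Reflection preserves
  \<open>E_of\<close>, exchanges the roles of \<open>Q_of\<close> and \<open>S_of\<close>, and
  carries segments and energies over, so the point found there can be pulled back.\<close>

lemma lower_scenarios_bound:
  assumes a: "\<forall>i. 0 < a$i" and s: "admissible cl s" and sc: "sc \<in> {Scenario4, Scenario5, Scenario6}"
  shows "\<exists>w\<in>closed_segment (Ay_star sc cl Minus) (Ay_star sc cl Plus).
    min (H_of (S_of a) (a$4) (a$3) (a$2)) (H_of (S_of a) (a$5) (a$3) (a$1)) * energy a (s - w)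
      \<le> sigma_of sc a * (cl Plus $ 4 + cl Plus $ 5 - s$4 - s$5)\<^sup>2"
proof -
  let ?a = "reflect a" and ?cl = "\<lambda>\<theta>. reflect (cl \<theta>)" and ?s = "reflect s"
  have a': "\<forall>i. 0 < ?a$i" using a by (simp add: forall_5)
  have s': "admissible ?cl ?s"
    using s by (auto simp: admissible_def balanced_def within_limits_def forall_5)
  have E: "E_of ?a = E_of a" by (simp add: E_of_def algebra_simps)
  have Q: "Q_of ?a = S_of a" by (simp add: Q_of_def S_of_def algebra_simps)
  have sc': "dual sc \<in> {Scenario1, Scenario2, Scenario3}" using sc by auto
  have \<sigma>: "sigma_of (dual sc) ?a = sigma_of sc a" using sc by (auto simp: E Q algebra_simps)
  have star: "Ay_star (dual sc) ?cl \<theta> = reflect (Ay_star sc cl \<theta>)" for \<theta>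
    using sc by (auto simp: vec_eq_5)
  have en: "energy ?a (reflect x) = energy a x" for x by (simp add: energy_5)
  obtain w where w: "w \<in> closed_segment (Ay_star (dual sc) ?cl Minus) (Ay_star (dual sc) ?cl Plus)"
    "min (H_of (Q_of ?a) (?a$2) (?a$3) (?a$4)) (H_of (Q_of ?a) (?a$1) (?a$3) (?a$5)) * energy ?a (?s - w)
      \<le> sigma_of (dual sc) ?a * (?cl Plus $ 1 + ?cl Plus $ 2 - ?s$1 - ?s$2)\<^sup>2"
    using upper_scenarios_bound[OF a' s' sc'] by blast
  from w(1) obtain v where v: "w = reflect v" "v \<in> closed_segment (Ay_star sc cl Minus) (Ay_star sc cl Plus)"
    unfolding star closed_segment_linear_image[OF linear_reflect] by blast
  have "energy ?a (?s - w) = energy a (s - v)"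
    using en[of "s - v"] by (simp add: v(1) linear_diff[OF linear_reflect])
  with w(2) v(2) show ?thesis
    unfolding \<sigma> Q by (auto intro!: bexI[of _ v] simp: algebra_simps)
qed

section \<open>Admissibility of the segment and the maximal load\<close>

lemma Ay_star_admissible:
  assumes lim: "\<forall>i. cl Minus $ i \<le> cl Plus $ i" and feas: "feasible sc cl"
  shows "admissible cl (Ay_star sc cl \<theta>)"
proof -
  have f: "feasible_at sc cl \<theta>" using feas by (simp add: feasible_def)
  have c: "within_limits cl i (cl \<theta> $ i)" "within_limits cl i (cl Plus $ i)" for i
    using lim by (cases \<theta>; simp add: within_limits_def)+
  show ?thesis using f c
    by (cases sc) (simp_all add: admissible_def balanced_def forall_5)
qed

lemma convex_admissible: "convex {s. admissible cl s}"
proof (rule convexI)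
  fix x y :: "real^5" and u v :: real
  assume "x \<in> {s. admissible cl s}" "y \<in> {s. admissible cl s}" and uv: "0 \<le> u" "0 \<le> v" "u + v = 1"
  then have x: "admissible cl x" and y: "admissible cl y" by auto
  have "cl Minus $ i \<le> u * x$i + v * y$i \<and> u * x$i + v * y$i \<le> cl Plus $ i" for i
    using x y uv convex_bound_le[of "x$i" "cl Plus $ i" "y$i" u v] convex_bound_le[of "- x$i" "- cl Minus $ i" "- y$i" u v]
    by (simp add: admissible_def within_limits_def)
  then show "u *\<^sub>R x + v *\<^sub>R y \<in> {s. admissible cl s}"
    using x y by (simp add: admissible_def balanced_def within_limits_def algebra_simps)
qed

lemma segment_admissible:
  assumes "\<forall>i. cl Minus $ i \<le> cl Plus $ i" "feasible sc cl"
    and "w \<in> closed_segment (Ay_star sc cl Minus) (Ay_star sc cl Plus)"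
  shows "admissible cl w"
  using closed_segment_subset[OF _ _ convex_admissible, of "Ay_star sc cl Minus" cl "Ay_star sc cl Plus"]
    Ay_star_admissible[OF assms(1,2)] assms(3) by blast

text \<open>The value of \<open>s$1 + s$2\<close> on the segment, and an upper bound for it on all
  admissible stresses. Summing over \<open>I0\<close> treats both groups of scenarios alike, since
  balanced stresses satisfy \<open>s$1 + s$2 = s$4 + s$5\<close>.\<close>

definition top_load :: "scenario \<Rightarrow> (side \<Rightarrow> real^5) \<Rightarrow> real" where
  "top_load sc cl = (\<Sum>(\<theta>, j)\<in>I0 sc. cl \<theta> $ j)"

lemma segment_I0:
  assumes "w \<in> closed_segment (Ay_star sc cl Minus) (Ay_star sc cl Plus)" and "(\<theta>, j) \<in> I0 sc"
  shows "w$j = cl \<theta> $ j"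
proof -
  obtain u where w: "w = (1 - u) *\<^sub>R Ay_star sc cl Minus + u *\<^sub>R Ay_star sc cl Plus"
    using assms(1) by (auto simp: closed_segment_def)
  have "Ay_star sc cl \<theta>' $ j = cl \<theta> $ j" for \<theta>' using assms(2) by (cases sc) auto
  then show ?thesis by (simp add: w algebra_simps)
qed

lemma balanced_load_I0:
  assumes "balanced s"
  shows "s$1 + s$2 = (\<Sum>(\<theta>, j)\<in>I0 sc. s$j)"
  using assms by (cases sc) (simp_all add: balanced_def)

lemma segment_load:
  assumes "\<forall>i. cl Minus $ i \<le> cl Plus $ i" "feasible sc cl"
    and w: "w \<in> closed_segment (Ay_star sc cl Minus) (Ay_star sc cl Plus)"
  shows "w$1 + w$2 = top_load sc cl"
proof -
  have "balanced w" using segment_admissible[OF assms] by (simp add: admissible_def)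
  then show ?thesis
    unfolding balanced_load_I0[OF \<open>balanced w\<close>, of sc] top_load_def
    using segment_I0[OF w] by (intro sum.cong) auto
qed

lemma admissible_load:
  assumes "admissible cl s"
  shows "s$1 + s$2 \<le> top_load sc cl"
proof -
  have *: "s$i \<le> cl Plus $ i" for i using assms by (simp add: admissible_def within_limits_def)
  have "\<theta> = Plus" if "(\<theta>, j) \<in> I0 sc" for \<theta> j using that by (cases sc) auto
  then have "(\<Sum>(\<theta>, j)\<in>I0 sc. s$j) \<le> top_load sc cl"
    unfolding top_load_def using * by (intro sum_mono) auto
  then show ?thesis using assms by (simp add: admissible_def balanced_load_I0[of s sc])
qed

section \<open>Linear growth of the load deficit away from the segment\<close>

lemma h_of_eq:
  assumes "0 < l1"
  shows "min (h_of a l1 q x y) (h_of a l1 q x' y') = l1 * sqrt (min (H_of q x (a$3) y) (H_of q x' (a$3) y'))"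
  using assms by (auto simp: h_of_def H_of_def min_def)

lemma sqrt_bound:
  fixes H e \<sigma> p l1 :: real
  assumes "H * e \<le> \<sigma> * p\<^sup>2" "0 \<le> p" "0 < l1"
  shows "l1 * sqrt H * sqrt e \<le> sqrt \<sigma> * (l1 * p)"
proof -
  have "sqrt (H * e) \<le> sqrt (\<sigma> * p\<^sup>2)" using assms(1) by (rule real_sqrt_le_mono)
  then have "sqrt H * sqrt e \<le> sqrt \<sigma> * p" using assms(2) by (simp add: real_sqrt_mult)
  then show ?thesis using assms(3) by (simp add: mult.left_commute mult.assoc)
qed

text \<open>Square roots turn the quadratic bounds into the sharpness condition of the drift
  argument, with rate \<open>eps0\<close> over the root of \<open>sigma_of\<close>. In the lower
  scenarios the load is read at springs 4 and 5.\<close>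

lemma scenario_sharpness:
  assumes a: "\<forall>i. 0 < a$i" and l1: "0 < l1" and s: "admissible cl s"
  shows "\<exists>w\<in>closed_segment (Ay_star sc cl Minus) (Ay_star sc cl Plus).
    eps0 sc a l1 * sqrt (energy a (s - w)) \<le> sqrt (sigma_of sc a) * (l1 * (top_load sc cl - (s$1 + s$2)))"
proof (cases "sc \<in> {Scenario1, Scenario2, Scenario3}")
  case True
  have eps: "eps0 sc a l1 = l1 * sqrt (min (H_of (Q_of a) (a$2) (a$3) (a$4)) (H_of (Q_of a) (a$1) (a$3) (a$5)))"
    using True by (auto simp: eps0_upper_def h_of_eq[OF l1])
  have t: "top_load sc cl = cl Plus $ 1 + cl Plus $ 2" using True by (auto simp: top_load_def)
  have nn: "0 \<le> cl Plus $ 1 + cl Plus $ 2 - s$1 - s$2" using admissible_load[OF s, of sc] t by simp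
  obtain w where w: "w \<in> closed_segment (Ay_star sc cl Minus) (Ay_star sc cl Plus)"
    "min (H_of (Q_of a) (a$2) (a$3) (a$4)) (H_of (Q_of a) (a$1) (a$3) (a$5)) * energy a (s - w)
      \<le> sigma_of sc a * (cl Plus $ 1 + cl Plus $ 2 - s$1 - s$2)\<^sup>2"
    using upper_scenarios_bound[OF a s True] by blast
  show ?thesis
    using sqrt_bound[OF w(2) nn l1] w(1) unfolding eps t by (auto simp: diff_diff_eq)
next
  case False
  then have sc: "sc \<in> {Scenario4, Scenario5, Scenario6}" by (cases sc) auto
  have eps: "eps0 sc a l1 = l1 * sqrt (min (H_of (S_of a) (a$4) (a$3) (a$2)) (H_of (S_of a) (a$5) (a$3) (a$1)))"
    using sc by (auto simp: eps0_lower_def h_of_eq[OF l1] min.commute)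
  have t: "top_load sc cl = cl Plus $ 4 + cl Plus $ 5" using sc by (auto simp: top_load_def)
  have s12: "s$1 + s$2 = s$4 + s$5" using s by (simp add: admissible_def balanced_def)
  have nn: "0 \<le> cl Plus $ 4 + cl Plus $ 5 - s$4 - s$5" using admissible_load[OF s, of sc] t s12 by simp
  obtain w where w: "w \<in> closed_segment (Ay_star sc cl Minus) (Ay_star sc cl Plus)"
    "min (H_of (S_of a) (a$4) (a$3) (a$2)) (H_of (S_of a) (a$5) (a$3) (a$1)) * energy a (s - w)
      \<le> sigma_of sc a * (cl Plus $ 4 + cl Plus $ 5 - s$4 - s$5)\<^sup>2"
    using lower_scenarios_bound[OF a s sc] by blast
  show ?thesis
    using sqrt_bound[OF w(2) nn l1] w(1) unfolding eps t s12 by (auto simp: diff_diff_eq)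
qed

lemma eps0_pos:
  assumes a: "\<forall>i. 0 < a$i" and "0 < l1"
  shows "0 < eps0 sc a l1"
proof -
  have pos: "0 < a$1" "0 < a$2" "0 < a$3" "0 < a$4" "0 < a$5" using a by auto
  have "0 < Q_of a" "0 < S_of a"
    unfolding Q_of_def S_of_def using pos by (intro add_pos_pos mult_pos_pos; simp)+
  then have "0 < eps0_upper a l1" "0 < eps0_lower a l1"
    using pos assms(2) by (simp_all add: eps0_upper_def eps0_lower_def h_of_def add_pos_pos)
  then show ?thesis by (cases sc) auto
qed

subsection \<open>Stresses as coordinates of the sweeping process\<close>

text \<open>Coordinates in which \<open>energy\<close> is the squared Euclidean norm, so that
  Euclidean projections can be used.\<close>

definition scaled :: "real^5 \<Rightarrow> real^5 \<Rightarrow> real^5" where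
  "scaled a s = (\<chi> i. s$i / sqrt (a$i))"

lemma linear_scaled: "linear (scaled a)"
  by (rule linearI) (simp_all add: scaled_def vec_eq_iff add_divide_distrib)

lemma scaled_inner:
  assumes "\<forall>i. 0 < a$i"
  shows "scaled a (stiffness a *v x) \<bullet> scaled a s = x \<bullet> s"
  using assms by (simp add: scaled_def inner_vec_def stiffness_mult_component divide_simps less_imp_le
      less_imp_neq[THEN not_sym])

lemma norm_scaled:
  assumes "\<forall>i. 0 < a$i"
  shows "norm (scaled a s) = sqrt (energy a s)"
  using assms by (simp add: norm_eq_sqrt_inner scaled_def inner_vec_def energy_def power2_eq_square less_imp_le)

lemma stiffness_surj:
  assumes "\<forall>i. 0 < a$i"
  shows "\<exists>x. stiffness a *v x = s"
proof
  show "stiffness a *v (\<chi> i. s$i / a$i) = s"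
    using assms by (simp add: vec_eq_iff stiffness_mult_component less_imp_neq[THEN not_sym])
qed

lemma V_space_balanced:
  assumes a: "\<forall>i. 0 < a$i"
  shows "x \<in> V_space a \<longleftrightarrow> balanced (stiffness a *v x)"
proof
  assume "x \<in> V_space a"
  then obtain v where "x = V_basis a *v v" by (auto simp: V_space_def)
  then have "stiffness a *v x = A_V_basis *v v"
    by (simp add: matrix_vector_mul_assoc A_V_basis_eq[OF a])
  then show "balanced (stiffness a *v x)"
    by (simp add: balanced_def A_V_basis_def matrix_vector_mult_def sum_3)
next
  define s where "s = stiffness a *v x"
  assume "balanced (stiffness a *v x)"
  then have b: "s$1 = s$3 + s$4" "s$5 = s$2 + s$3" by (auto simp: balanced_def s_def)
  \<comment> \<open>The solution of the first three rows of \<open>A_V_basis *v v = s\<close>;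
    balance provides the other two.\<close>
  define v :: "real^3" where "v = vector [s$3 - (s$1 - s$2) / 2, (s$1 + s$2) / 2, (s$1 - s$2) / 2]"
  have "A_V_basis *v v = s"
    by (simp add: vec_eq_5 A_V_basis_def v_def matrix_vector_mult_def sum_3 b field_simps)
  then have "(V_basis a *v v) $ i = x$i" for i
    using a by (simp add: V_basis_mult_component[OF a] s_def stiffness_mult_component less_imp_neq[THEN not_sym])
  then have "x = V_basis a *v v" by (simp add: vec_eq_iff)
  then show "x \<in> V_space a" by (auto simp: V_space_def)
qed

lemma elastic_set_admissible:
  assumes "\<forall>i. 0 < a$i"
  shows "x \<in> elastic_set a cl \<longleftrightarrow> admissible cl (stiffness a *v x)"
  by (simp add: elastic_set_def V_space_balanced[OF assms] admissible_def within_limits_def inner_A_def inner_axis')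

definition loading_direction :: "real^5 \<Rightarrow> real^5" where
  "loading_direction a = (V_basis a ** matrix_inv (P_mat ** V_basis a)) *v vector [1, 0, 0]"

lemma offset_eq: "offset a l t = - (l t *\<^sub>R loading_direction a)"
  by (simp add: offset_def loading_direction_def matrix_vector_mult_scaleR)

lemma loading_direction_in_V: "loading_direction a \<in> V_space a"
  by (auto simp: loading_direction_def V_space_def matrix_vector_mul_assoc[symmetric])

lemma matrix_inv_right:
  assumes "invertible M"
  shows "M ** matrix_inv M = mat 1"
  using someI_ex[OF assms[unfolded invertible_def]] by (simp add: matrix_inv_def)

text \<open>A form of virtual work. The matrix inverse enters only through
  \<open>P_mat *v d = (1, 0, 0)\<close> for the loading direction \<open>d\<close>: two of these
  equations express the elongations of springs 2 and 4 by the others, and pairing with a balanced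
  stress then leaves the prescribed total elongation 1 times the load.\<close>

lemma loading_direction_inner:
  assumes a: "\<forall>i. 0 < a$i" and s: "balanced s"
  shows "loading_direction a \<bullet> s = s$1 + s$2"
proof -
  let ?d = "loading_direction a"
  have "P_mat *v ?d = (P_mat ** V_basis a ** matrix_inv (P_mat ** V_basis a)) *v vector [1, 0, 0]"
    by (simp add: loading_direction_def matrix_vector_mul_assoc matrix_mul_assoc)
  also have "\<dots> = vector [1, 0, 0]"
    by (simp add: matrix_inv_right[OF invertible_P_mat_V_basis[OF a]])
  finally have "(P_mat *v ?d) $ i = (vector [1, 0, 0] :: real^3) $ i" for i by simp
  from this[of 1] this[of 2] this[of 3]
  have P: "?d$1 + ?d$3 + ?d$5 = 1" "?d$3 - ?d$4 + ?d$5 = 0" "?d$1 - ?d$2 + ?d$3 = 0"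
    by (simp_all add: P_mat_def matrix_vector_mult_def sum_5)
  then have d: "?d$4 = ?d$3 + ?d$5" "?d$2 = ?d$1 + ?d$3" "?d$1 = 1 - ?d$3 - ?d$5" by auto
  have "?d \<bullet> s = (?d$1 + ?d$3 + ?d$5) * (s$2 + s$3 + s$4)"
    using s unfolding balanced_def inner_vec_def sum_5 d(1,2) by (simp add: algebra_simps)
  then show ?thesis using s by (simp add: P(1) balanced_def)
qed

definition stress_map :: "real^5 \<Rightarrow> real^5 \<Rightarrow> real^5" where
  "stress_map a x = scaled a (stiffness a *v x)"

lemma bounded_linear_stress_map: "bounded_linear (stress_map a)"
  unfolding stress_map_def
  by (intro bounded_linear_compose[OF linear_conv_bounded_linear[THEN iffD1, OF linear_scaled]] matrix_vector_mul_bounded_linear)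

lemma stress_map_inner:
  assumes "\<forall>i. 0 < a$i"
  shows "stress_map a x \<bullet> stress_map a y = inner_A a x y"
  by (simp add: stress_map_def scaled_inner[OF assms] inner_A_def)

lemma scaled_stress: "scaled a (stress a l y t) = stress_map a (y t - offset a l t)"
  by (simp add: stress_def stress_map_def)

lemma moving_set_iff:
  assumes "\<forall>i. 0 < a$i"
  shows "y \<in> moving_set a cl l t \<longleftrightarrow> admissible cl (stiffness a *v (y - offset a l t))"
  unfolding elastic_set_admissible[OF assms, symmetric] moving_set_def
  by (auto intro!: image_eqI[of _ _ "y - offset a l t"])

lemma offset_affine:
  assumes "\<forall>t. l t = l\<^sub>0 + l\<^sub>1 * t"
  shows "offset a l u - offset a l v = - ((l\<^sub>1 * (u - v)) *\<^sub>R loading_direction a)"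
    and "(offset a l has_vector_derivative - (l\<^sub>1 *\<^sub>R loading_direction a)) (at t within S)"
proof -
  show "offset a l u - offset a l v = - ((l\<^sub>1 * (u - v)) *\<^sub>R loading_direction a)"
    unfolding offset_eq using assms by (simp add: algebra_simps)
  have "offset a l = (\<lambda>t. - ((l\<^sub>0 + l\<^sub>1 * t) *\<^sub>R loading_direction a))"
    using assms by (simp add: fun_eq_iff offset_eq)
  then show "(offset a l has_vector_derivative - (l\<^sub>1 *\<^sub>R loading_direction a)) (at t within S)"
    by (auto intro!: derivative_eq_intros simp: has_real_derivative_iff_has_vector_derivative[symmetric])
qed

section \<open>Size of the admissible set, settling of solutions and constant solutions\<close>

lemma bounded_admissible: "bounded {s. admissible cl s}"
  by (rule bounded_subset[OF bounded_cbox[of "cl Minus" "cl Plus"]])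
    (auto simp: admissible_def within_limits_def mem_box_cart)

lemma energy_difference_le:
  assumes a: "\<forall>i. 0 < a$i" and "admissible cl s" "admissible cl w"
  shows "energy a (s - w) \<le> energy a (cl Plus - cl Minus)"
  unfolding energy_def
proof (rule sum_mono)
  fix i
  have "\<bar>s$i - w$i\<bar> \<le> \<bar>cl Plus $ i - cl Minus $ i\<bar>"
    using assms(2,3) by (auto simp: admissible_def within_limits_def abs_le_iff dest!: spec[of _ i])
  then have "((s - w)$i)\<^sup>2 \<le> ((cl Plus - cl Minus)$i)\<^sup>2" by (simp add: abs_le_square_iff)
  then show "((s - w)$i)\<^sup>2 / a$i \<le> ((cl Plus - cl Minus)$i)\<^sup>2 / a$i"
    using a by (simp add: divide_right_mono less_imp_le)
qed

lemma norm_A_limits: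
  assumes a: "\<forall>i. 0 < a$i"
  shows "norm_A a (matrix_inv (stiffness a) *v c - matrix_inv (stiffness a) *v c') = sqrt (energy a (c - c'))"
proof -
  let ?B = "matrix_inv (stiffness a)"
  have B: "(?B *v x)$i = x$i / a$i" for x i
    by (simp add: matrix_inv_stiffness[OF a] matrix_vector_mult_def if_distrib[of "\<lambda>z. z * _"] divide_inverse_commute cong: if_cong)
  have "inner_A a (?B *v x) (?B *v x) = energy a x" for x
    using a by (simp add: inner_A_def inner_vec_def stiffness_mult_component B energy_def power2_eq_square less_imp_neq[THEN not_sym])
  then show ?thesis
    by (simp add: norm_A_def matrix_vector_mult_diff_distrib[symmetric])
qed

text \<open>Subtracting the offset makes the moving set stationary and adds the constant drift
  \<open>g\<close>; \<open>stress_map\<close> makes the geometry Euclidean. The drift result then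
  applies to the image \<open>F\<close> of the segment, and \<open>tau_d\<close> is the initial
  distance bound divided by the rate \<open>\<kappa>\<close>.\<close>

lemma solution_stress_settles:
  assumes a: "\<forall>i. 0 < a $ i" and lim: "\<forall>i. cl Minus $ i \<le> cl Plus $ i"
    and l1: "0 < l\<^sub>1" and l: "\<forall>t. l t = l\<^sub>0 + l\<^sub>1 * t" and feas: "feasible sc cl"
    and y: "sweeping_solution a cl l y"
  shows "\<exists>w\<in>closed_segment (Ay_star sc cl Minus) (Ay_star sc cl Plus).
    \<forall>t\<ge>tau_d a cl (sigma_of sc a) (sigma_of sc a) (eps0 sc a l\<^sub>1). stress a l y t = w"
proof -
  let ?seg = "closed_segment (Ay_star sc cl Minus) (Ay_star sc cl Plus)"
  let ?\<tau> = "tau_d a cl (sigma_of sc a) (sigma_of sc a) (eps0 sc a l\<^sub>1)"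
  let ?d = "loading_direction a"
  define z where "z t = stress_map a (y t - offset a l t)" for t
  define g where "g = stress_map a (l\<^sub>1 *\<^sub>R ?d)"
  define C where "C = scaled a ` {s. admissible cl s}"
  define F where "F = scaled a ` ?seg"
  define \<kappa> where "\<kappa> = eps0 sc a l\<^sub>1 / sqrt (sigma_of sc a)"
  have eps: "0 < eps0 sc a l\<^sub>1" by (rule eps0_pos[OF a l1])
  have \<sigma>: "0 < sqrt (sigma_of sc a)" using sigma_of_ge_1[of sc a] by simp
  interpret T: bounded_linear "stress_map a" by (rule bounded_linear_stress_map)
  have adm: "admissible cl (stress a l y t)" if "0 \<le> t" for t
    using y that moving_set_iff[OF a] by (simp add: sweeping_solution_def stress_def)
  have z_stress: "z t = scaled a (stress a l y t)" for t
    by (simp add: z_def scaled_stress)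
  have "\<exists>w\<in>F. \<forall>t\<ge>?\<tau>. z t = w"
  proof (rule constant_drift_reaches_face)
    obtain K where K: "0 \<le> K" "\<And>x. norm (stress_map a x) \<le> norm x * K" using T.nonneg_bounded by blast
    fix s t :: real assume "0 \<le> s"
    then have "absolutely_continuous_on y {s..t}"
      using y by (auto simp: sweeping_solution_def locally_absolutely_continuous_on_def)
    then show "absolutely_continuous_on z {s..t}"
    proof (rule absolutely_continuous_on_dominated)
      fix u v :: real
      have "norm (z u - z v) = norm (stress_map a ((y u - y v) - (offset a l u - offset a l v)))"
        by (simp add: z_def T.diff T.add algebra_simps)
      also have "\<dots> \<le> norm ((y u - y v) - (offset a l u - offset a l v)) * K" by (rule K(2))
      also have "\<dots> \<le> (norm (y u - y v) + norm (offset a l u - offset a l v)) * K"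
        by (intro mult_right_mono norm_triangle_ineq4 K(1))
      also have "norm (offset a l u - offset a l v) = l\<^sub>1 * \<bar>u - v\<bar> * norm ?d"
        using l1 by (simp add: offset_affine(1)[OF l] abs_mult)
      finally show "norm (z u - z v) \<le> K * norm (y u - y v) + (K * l\<^sub>1 * norm ?d) * \<bar>u - v\<bar>"
        by (simp add: algebra_simps)
    qed
  next
    show "z t \<in> C" if "0 \<le> t" for t using adm[OF that] by (auto simp: C_def z_stress)
    show "bounded C"
      unfolding C_def
      by (intro bounded_linear_image bounded_admissible linear_conv_bounded_linear[THEN iffD1] linear_scaled)
    have "AE t in lebesgue. t \<ge> 0 \<longrightarrow>
        (\<exists>y'. (y has_vector_derivative y') (at t within {0..}) \<and>
              - y' \<in> normal_cone a (moving_set a cl l t) (y t))"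
      using y by (simp add: sweeping_solution_def)
    then show "AE t in lebesgue. 0 \<le> t \<longrightarrow>
      (\<exists>z'. (z has_vector_derivative z') (at t within {0..}) \<and> (\<forall>\<xi>\<in>C. (g - z') \<bullet> (\<xi> - z t) \<le> 0))"
    proof (rule AE_mp, intro AE_I2 impI)
      fix t assume t: "(0::real) \<le> t" and "0 \<le> t \<longrightarrow> (\<exists>y'. (y has_vector_derivative y') (at t within {0..}) \<and>
              - y' \<in> normal_cone a (moving_set a cl l t) (y t))"
      then obtain y' where y': "(y has_vector_derivative y') (at t within {0..})"
        and cone: "- y' \<in> normal_cone a (moving_set a cl l t) (y t)" by blast
      \<comment> \<open>The offset has velocity \<open>- l\<^sub>1 *\<^sub>R ?d\<close>, so
        \<open>g\<close> minus the derivative of \<open>z\<close> is the image of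
        \<open>- y'\<close>, and the normal cone condition becomes the variational
        inequality.\<close>
      have "(z has_vector_derivative stress_map a (y' - (- (l\<^sub>1 *\<^sub>R ?d)))) (at t within {0..})"
        unfolding z_def
        by (rule T.has_vector_derivative has_vector_derivative_diff y' offset_affine(2)[OF l])+
      moreover have "(g - stress_map a (y' - (- (l\<^sub>1 *\<^sub>R ?d)))) \<bullet> (\<xi> - z t) \<le> 0" if \<xi>: "\<xi> \<in> C" for \<xi>
      proof -
        obtain s where s: "\<xi> = scaled a s" "admissible cl s" using \<xi> by (auto simp: C_def)
        obtain x where x: "stiffness a *v x = s" using stiffness_surj[OF a] by blast
        have "x + offset a l t \<in> moving_set a cl l t"
          using s x by (simp add: moving_set_iff[OF a])
        then have "inner_A a (- y') ((x + offset a l t) - y t) \<le> 0"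
          using cone by (simp add: normal_cone_def)
        moreover have "g - stress_map a (y' - (- (l\<^sub>1 *\<^sub>R ?d))) = stress_map a (- y')"
          by (simp add: g_def T.diff[symmetric])
        moreover have "\<xi> - z t = stress_map a ((x + offset a l t) - y t)"
          using x by (simp add: s z_def T.diff T.add stress_map_def[of a x])
        ultimately show ?thesis by (simp add: stress_map_inner[OF a])
      qed
      ultimately show "\<exists>z'. (z has_vector_derivative z') (at t within {0..}) \<and> (\<forall>\<xi>\<in>C. (g - z') \<bullet> (\<xi> - z t) \<le> 0)"
        by blast
    qed
  next
    show "F \<subseteq> C" using segment_admissible[OF lim feas] by (auto simp: F_def C_def)
    show "closed F"
      unfolding F_def closed_segment_linear_image[OF linear_scaled, symmetric]
      by (intro compact_imp_closed compact_segment)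
    show "convex F"
      unfolding F_def by (intro convex_linear_image linear_scaled convex_closed_segment)
    show "F \<noteq> {}" by (simp add: F_def)
    show "0 < \<kappa>" using eps \<sigma> by (simp add: \<kappa>_def)
  next
    fix x w assume "x \<in> C" "w \<in> F"
    then obtain s v where s: "x = scaled a s" "admissible cl s" and v: "w = scaled a v" "v \<in> ?seg"
      by (auto simp: C_def F_def)
    obtain v' where v': "v' \<in> ?seg"
      "eps0 sc a l\<^sub>1 * sqrt (energy a (s - v')) \<le> sqrt (sigma_of sc a) * (l\<^sub>1 * (top_load sc cl - (s$1 + s$2)))"
      using scenario_sharpness[OF a l1 s(2)] by blast
    have "infdist x F \<le> norm (scaled a s - scaled a v')"
      using v'(1) by (simp add: s F_def infdist_le flip: dist_norm)
    also have "\<dots> = sqrt (energy a (s - v'))"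
      by (simp add: linear_diff[OF linear_scaled, symmetric] norm_scaled[OF a])
    finally have "\<kappa> * infdist x F \<le> \<kappa> * sqrt (energy a (s - v'))"
      using eps \<sigma> by (intro mult_left_mono) (auto simp: \<kappa>_def)
    also have "\<dots> \<le> l\<^sub>1 * (top_load sc cl - (s$1 + s$2))"
      using v'(2) \<sigma> by (simp add: \<kappa>_def divide_le_eq mult.commute)
    also have "\<dots> = l\<^sub>1 * ((v$1 + v$2) - (s$1 + s$2))"
      by (simp add: segment_load[OF lim feas v(2)])
    also have "\<dots> = l\<^sub>1 * (?d \<bullet> v - ?d \<bullet> s)"
      using loading_direction_inner[OF a] s(2) segment_admissible[OF lim feas v(2)] by (simp add: admissible_def)
    also have "\<dots> = g \<bullet> (w - x)"
      by (simp add: g_def T.scaleR s v stress_map_def scaled_inner[OF a] inner_diff_right right_diff_distrib)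
    finally show "\<kappa> * infdist x F \<le> g \<bullet> (w - x)" .
  next
    \<comment> \<open>Any point of the segment would serve: two admissible stresses differ in each
      component by at most the gap between the limits, which yields the norm in
      \<open>tau_d\<close>.\<close>
    let ?w = "Ay_star sc cl Plus"
    have "infdist (z 0) F \<le> norm (z 0 - scaled a ?w)"
      unfolding F_def by (simp add: infdist_le flip: dist_norm)
    also have "\<dots> = sqrt (energy a (stress a l y 0 - ?w))"
      by (simp add: z_stress linear_diff[OF linear_scaled, symmetric] norm_scaled[OF a])
    also have "\<dots> \<le> sqrt (energy a (cl Plus - cl Minus))"
      by (intro real_sqrt_le_mono energy_difference_le[OF a adm[OF order_refl]] Ay_star_admissible[OF lim feas])
    also have "\<dots> = \<kappa> * ?\<tau>"
      using eps \<sigma> by (simp add: \<kappa>_def tau_d_def norm_A_limits[OF a])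
    finally show "infdist (z 0) F \<le> \<kappa> * ?\<tau>" .
  qed
  then obtain w where w: "w \<in> ?seg" "\<forall>t\<ge>?\<tau>. scaled a (stress a l y t) = scaled a w"
    unfolding F_def z_stress by blast
  have "s = v" if "scaled a s = scaled a v" for s v
    using that a by (simp add: scaled_def vec_eq_iff less_imp_neq[THEN not_sym])
  with w(2) have "\<forall>t\<ge>?\<tau>. stress a l y t = w" by simp
  with w(1) show ?thesis ..
qed

text \<open>A point carried along with the moving set keeps its stress \<open>w\<close>. Its
  negative velocity is a positive multiple of the loading direction, which is normal to the set
  because \<open>w\<close> maximises the load.\<close>

lemma constant_stress_solution:
  assumes a: "\<forall>i. 0 < a $ i" and lim: "\<forall>i. cl Minus $ i \<le> cl Plus $ i"
    and l1: "0 < l\<^sub>1" and l: "\<forall>t. l t = l\<^sub>0 + l\<^sub>1 * t" and feas: "feasible sc cl"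
    and w: "w \<in> closed_segment (Ay_star sc cl Minus) (Ay_star sc cl Plus)"
  shows "\<exists>y. sweeping_solution a cl l y \<and> (\<forall>t. stress a l y t = w)"
proof -
  let ?d = "loading_direction a"
  obtain x where x: "stiffness a *v x = w" using stiffness_surj[OF a] by blast
  define y where "y t = x + offset a l t" for t
  have adm: "admissible cl w" by (rule segment_admissible[OF lim feas w])
  have mem: "y t \<in> moving_set a cl l t" for t
    using adm x by (simp add: moving_set_iff[OF a] y_def)
  have ac: "locally_absolutely_continuous_on y {0..}"
    unfolding locally_absolutely_continuous_on_def
  proof (intro allI impI)
    fix u v :: real
    \<comment> \<open>Domination by the zero map leaves only the term in time, so the Lipschitz
      motion of the offset suffices.\<close>
    have "absolutely_continuous_on (\<lambda>_. 0) {u..v}"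
      unfolding absolutely_continuous_on_def by (intro allI impI exI[of _ 1]) simp
    then show "absolutely_continuous_on y {u..v}"
    proof (rule absolutely_continuous_on_dominated)
      fix s t :: real
      show "norm (y s - y t) \<le> 0 * norm (0 - 0 :: real^5) + (l\<^sub>1 * norm ?d) * \<bar>s - t\<bar>"
        using l1 by (simp add: y_def offset_affine(1)[OF l] abs_mult)
    qed
  qed
  have deriv: "(y has_vector_derivative - (l\<^sub>1 *\<^sub>R ?d)) (at t within {0..})" for t
  proof -
    have "((\<lambda>t. x + offset a l t) has_vector_derivative 0 + (- (l\<^sub>1 *\<^sub>R ?d))) (at t within {0..})"
      by (intro has_vector_derivative_add has_vector_derivative_const offset_affine(2)[OF l])
    then show ?thesis by (simp add: y_def[abs_def])
  qed
  have cone: "- (- (l\<^sub>1 *\<^sub>R ?d)) \<in> normal_cone a (moving_set a cl l t) (y t)" for t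
    unfolding normal_cone_def
  proof (intro CollectI conjI ballI mem)
    have "?d \<in> V_space a" by (rule loading_direction_in_V)
    then obtain v where "?d = V_basis a *v v" by (auto simp: V_space_def)
    then have "- (- (l\<^sub>1 *\<^sub>R ?d)) = V_basis a *v (l\<^sub>1 *\<^sub>R v)" by (simp add: matrix_vector_mult_scaleR)
    then show "- (- (l\<^sub>1 *\<^sub>R ?d)) \<in> V_space a" by (auto simp: V_space_def)
    fix \<xi> assume \<xi>: "\<xi> \<in> moving_set a cl l t"
    define s where "s = stiffness a *v (\<xi> - offset a l t)"
    have s: "admissible cl s" using \<xi> by (simp add: s_def moving_set_iff[OF a])
    have "stiffness a *v (\<xi> - y t) = s - w"
      unfolding s_def x[symmetric] matrix_vector_mult_diff_distrib[symmetric] by (simp add: y_def algebra_simps)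
    then have "inner_A a (- (- (l\<^sub>1 *\<^sub>R ?d))) (\<xi> - y t) = l\<^sub>1 * (?d \<bullet> s - ?d \<bullet> w)"
      by (simp add: inner_A_def inner_diff_right right_diff_distrib)
    also have "\<dots> = l\<^sub>1 * ((s$1 + s$2) - top_load sc cl)"
      using loading_direction_inner[OF a] s adm segment_load[OF lim feas w] by (simp add: admissible_def)
    also have "\<dots> \<le> 0" using admissible_load[OF s, of sc] l1 by (simp add: mult_nonneg_nonpos)
    finally show "inner_A a (- (- (l\<^sub>1 *\<^sub>R ?d))) (\<xi> - y t) \<le> 0" .
  qed
  have "sweeping_solution a cl l y"
    unfolding sweeping_solution_def
    by (intro conjI ac allI impI mem AE_I2 exI[of _ "- (l\<^sub>1 *\<^sub>R ?d)"] deriv cone)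
  moreover have "stress a l y t = w" for t by (simp add: stress_def y_def x)
  ultimately show ?thesis by blast
qed

theorem proposition9:
  fixes a :: "real^5" and cl :: "side \<Rightarrow> real^5" and l\<^sub>0 l\<^sub>1 :: real
    and l :: "real \<Rightarrow> real" and sc :: scenario and \<tau> :: real
  assumes "\<forall>i. 0 < a $ i"
    and "\<forall>i. cl Minus $ i \<le> cl Plus $ i"
    and "0 < l\<^sub>0" and "0 < l\<^sub>1"
    and "\<forall>t. l t = l\<^sub>0 + l\<^sub>1 * t"
    and "feasible sc cl"
    and "\<tau> = tau_d a cl (sigma_of sc a) (sigma_of sc a) (eps0 sc a l\<^sub>1)"
  shows "(\<forall>y. sweeping_solution a cl l y \<longrightarrow>
            (\<forall>t\<ge>\<tau>. \<forall>(\<theta>, j) \<in> I0 sc.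
               plastic cl (stress a l y t) j \<and> stress a l y t $ j = cl \<theta> $ j) \<and>
            (\<exists>w \<in> closed_segment (Ay_star sc cl Minus) (Ay_star sc cl Plus).
               \<forall>t\<ge>\<tau>. stress a l y t = w)) \<and>
         (\<forall>w \<in> closed_segment (Ay_star sc cl Minus) (Ay_star sc cl Plus).
            \<exists>y. sweeping_solution a cl l y \<and> (\<forall>t\<ge>\<tau>. stress a l y t = w))"
proof (intro conjI allI impI ballI)
  fix y assume y: "sweeping_solution a cl l y"
  obtain w where w: "w \<in> closed_segment (Ay_star sc cl Minus) (Ay_star sc cl Plus)"
    "\<And>t. \<tau> \<le> t \<Longrightarrow> stress a l y t = w"
    using solution_stress_settles[OF assms(1,2,4-6) y] assms(7) by blast
  show "\<exists>w \<in> closed_segment (Ay_star sc cl Minus) (Ay_star sc cl Plus). \<forall>t\<ge>\<tau>. stress a l y t = w"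
    using w by blast
  fix t p assume t: "\<tau> \<le> t" and "p \<in> I0 sc"
  then obtain \<theta> j where p: "p = (\<theta>, j)" "(\<theta>, j) \<in> I0 sc" by (cases p) auto
  have "w $ j = cl \<theta> $ j" by (rule segment_I0[OF w(1) p(2)])
  then show "case p of (\<theta>, j) \<Rightarrow> plastic cl (stress a l y t) j \<and> stress a l y t $ j = cl \<theta> $ j"
    using w(2)[OF t] p(1) by (cases \<theta>) (simp_all add: plastic_def)
next
  fix w assume "w \<in> closed_segment (Ay_star sc cl Minus) (Ay_star sc cl Plus)"
  from constant_stress_solution[OF assms(1,2,4-6) this]
  show "\<exists>y. sweeping_solution a cl l y \<and> (\<forall>t\<ge>\<tau>. stress a l y t = w)" by blast
qed

end
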